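(* Let $E$ be an elliptic curve over $\mathbb{Q}$ without complex multiplication. Suppose that $\mathbb{Q}(E[3]) = \mathbb{Q}(\zeta_3)$ and that $3 \mid \Delta_E^{sf}$, where $\Delta_E^{sf}$ is the squarefree part of the discriminant of $E$. Let $m$ be the positive integer defined by $$3m = \begin{cases} 2|\Delta_E^{sf}| & \text{if } \Delta_E^{sf} \equiv 1 \bmod 4, \\ 4|\Delta_E^{sf}| & \text{otherwise.}\end{cases}$$ Then $\mathbb{Q}(E[m]) = \mathbb{Q}(E[3m])$.
   Context: For a positive integer $n$, $\mathbb{Q}(E[n])$ denotes the $n$-division field of $E$ and $\zeta_3$ a primitive cube root of unity. If $\Delta_E$ is the discriminant of a Weierstrass equation of $E$ over $\mathbb{Q}$, the squarefree part $\Delta_E^{sf}$ is the unique squarefree integer (with sign) such that $\Delta_E / \Delta_E^{sf}$ is a nonzero rational square; it does not depend on the choice of equation. *)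

theory Defs
  imports
    "HOL-Algebra.Algebraic_Closure_Type"
    "HOL-Algebra.Generated_Fields"
    "HOL-Computational_Algebra.Squarefree"
    "HOL-Number_Theory.Cong"
begin

section \<open>Weierstrass curves and the group law\<close>

text \<open>
  The equation \<open>y\<^sup>2 + a\<^sub>1 x y + a\<^sub>3 y = x\<^sup>3 + a\<^sub>2 x\<^sup>2 + a\<^sub>4 x + a\<^sub>6\<close>.  The map function
  \<open>map_weierstrass\<close> of the datatype is base change.
\<close>

datatype 'a weierstrass =
  Weierstrass (wa1: 'a) (wa2: 'a) (wa3: 'a) (wa4: 'a) (wa6: 'a)

definition discriminant :: "'a::field weierstrass \<Rightarrow> 'a" where
  "discriminant E =
    (let b2 = wa1 E ^ 2 + 4 * wa2 E;
         b4 = 2 * wa4 E + wa1 E * wa3 E;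
         b6 = wa3 E ^ 2 + 4 * wa6 E;
         b8 = wa1 E ^ 2 * wa6 E + 4 * wa2 E * wa6 E - wa1 E * wa3 E * wa4 E
              + wa2 E * wa3 E ^ 2 - wa4 E ^ 2
     in - (b2 ^ 2 * b8) - 8 * b4 ^ 3 - 27 * b6 ^ 2 + 9 * b2 * b4 * b6)"

definition elliptic_curve :: "'a::field weierstrass \<Rightarrow> bool" where
  "elliptic_curve E \<longleftrightarrow> discriminant E \<noteq> 0"

datatype 'a point = Origin | Affine 'a 'a

definition points :: "'a::field weierstrass \<Rightarrow> 'a point set" where
  "points E = insert Origin
    {Affine x y | x y.
      y ^ 2 + wa1 E * x * y + wa3 E * y = x ^ 3 + wa2 E * x ^ 2 + wa4 E * x + wa6 E}"

fun point_neg :: "'a::field weierstrass \<Rightarrow> 'a point \<Rightarrow> 'a point" where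
  "point_neg E Origin = Origin"
| "point_neg E (Affine x y) = Affine x (- y - wa1 E * x - wa3 E)"

text \<open>
  Chord-tangent addition; \<open>l\<close> is the slope of the line through the two points
  (the tangent line if they coincide).
\<close>

fun point_add :: "'a::field weierstrass \<Rightarrow> 'a point \<Rightarrow> 'a point \<Rightarrow> 'a point" where
  "point_add E Origin Q = Q"
| "point_add E P Origin = P"
| "point_add E (Affine x1 y1) (Affine x2 y2) =
    (if x1 = x2 \<and> y1 + y2 + wa1 E * x2 + wa3 E = 0 then Origin
     else
       let l = (if x1 = x2
                then (3 * x1 ^ 2 + 2 * wa2 E * x1 + wa4 E - wa1 E * y1)
                     / (2 * y1 + wa1 E * x1 + wa3 E)
                else (y2 - y1) / (x2 - x1));
           x3 = l ^ 2 + wa1 E * l - wa2 E - x1 - x2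
       in Affine x3 (- (y1 + l * (x3 - x1)) - wa1 E * x3 - wa3 E))"

definition nat_mult :: "'a::field weierstrass \<Rightarrow> nat \<Rightarrow> 'a point \<Rightarrow> 'a point" where
  "nat_mult E n P = (point_add E P ^^ n) Origin"

definition int_mult :: "'a::field weierstrass \<Rightarrow> int \<Rightarrow> 'a point \<Rightarrow> 'a point" where
  "int_mult E k P =
    (if k \<ge> 0 then nat_mult E (nat k) P else point_neg E (nat_mult E (nat (- k)) P))"

definition torsion :: "'a::field weierstrass \<Rightarrow> nat \<Rightarrow> 'a point set" where
  "torsion E n = {P \<in> points E. nat_mult E n P = Origin}"


section \<open>Division fields\<close>

type_synonym qbar = "rat alg_closure"

abbreviation base_change_qbar :: "rat weierstrass \<Rightarrow> qbar weierstrass" where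
  "base_change_qbar E \<equiv> map_weierstrass to_ac E"

definition adjoin_rat :: "qbar set \<Rightarrow> qbar set" where
  "adjoin_rat S = generate_field ring_of_type_algebra (range to_ac \<union> S)"

definition division_field :: "rat weierstrass \<Rightarrow> nat \<Rightarrow> qbar set" where
  "division_field E n =
    adjoin_rat (\<Union>{{x, y} | x y. Affine x y \<in> torsion (base_change_qbar E) n})"


section \<open>Complex multiplication\<close>

fun homogeneous :: "'a::field point \<Rightarrow> 'a \<times> 'a \<times> 'a" where
  "homogeneous Origin = (0, 1, 0)"
| "homogeneous (Affine x y) = (x, y, 1)"

definition proj_eq :: "'a::field \<times> 'a \<times> 'a \<Rightarrow> 'a \<times> 'a \<times> 'a \<Rightarrow> bool" where
  "proj_eq = (\<lambda>(x, y, z) (x', y', z'). \<exists>c. c \<noteq> 0 \<and> x = c * x' \<and> y = c * y' \<and> z = c * z')"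

text \<open>
  Value of the ternary form of degree \<open>d\<close> whose coefficient at \<open>x\<^sup>i y\<^sup>j z\<^sup>d\<^sup>-\<^sup>i\<^sup>-\<^sup>j\<close> is \<open>c i j\<close>.
\<close>

definition form_eval :: "nat \<Rightarrow> (nat \<Rightarrow> nat \<Rightarrow> 'a::field) \<Rightarrow> 'a \<times> 'a \<times> 'a \<Rightarrow> 'a" where
  "form_eval d c = (\<lambda>(x, y, z). \<Sum>i\<le>d. \<Sum>j\<le>d - i. c i j * x ^ i * y ^ j * z ^ (d - i - j))"

text \<open>
  Morphisms \<open>E \<rightarrow> E\<close> of projective plane curves over an algebraically closed field, given by their
  action on points: near every point, the map is represented by three forms of the same degree
  without common zero at that point.
\<close>

definition curve_morphism :: "'a::alg_closed_field weierstrass \<Rightarrow> ('a point \<Rightarrow> 'a point) \<Rightarrow> bool" where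
  "curve_morphism E f \<longleftrightarrow>
    f ` points E \<subseteq> points E \<and>
    (\<forall>P\<in>points E. \<exists>d F G H.
      (let \<phi> = (\<lambda>Q. (form_eval d F (homogeneous Q), form_eval d G (homogeneous Q),
                      form_eval d H (homogeneous Q)))
       in \<phi> P \<noteq> (0, 0, 0) \<and>
          (\<forall>Q\<in>points E. \<phi> Q \<noteq> (0, 0, 0) \<longrightarrow> proj_eq (homogeneous (f Q)) (\<phi> Q))))"

definition curve_endomorphism :: "'a::alg_closed_field weierstrass \<Rightarrow> ('a point \<Rightarrow> 'a point) \<Rightarrow> bool" where
  "curve_endomorphism E f \<longleftrightarrow> curve_morphism E f \<and> f Origin = Origin"

text \<open>
  Complex multiplication is geometric: some endomorphism defined over the algebraic closure is not
  multiplication by an integer.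
\<close>

definition has_complex_multiplication :: "rat weierstrass \<Rightarrow> bool" where
  "has_complex_multiplication E \<longleftrightarrow>
    (\<exists>f. curve_endomorphism (base_change_qbar E) f \<and>
         \<not> (\<exists>k. \<forall>P\<in>points (base_change_qbar E). f P = int_mult (base_change_qbar E) k P))"


section \<open>The squarefree part of a nonzero rational number\<close>

definition is_squarefree_part :: "rat \<Rightarrow> int \<Rightarrow> bool" where
  "is_squarefree_part r d \<longleftrightarrow> squarefree d \<and> (\<exists>q. q \<noteq> 0 \<and> r / of_int d = q ^ 2)"

definition rat_squarefree_part :: "rat \<Rightarrow> int" where
  "rat_squarefree_part r = (THE d. is_squarefree_part r d)"

lemma ex1_squarefree_part:
  assumes "r \<noteq> 0"
  shows "\<exists>!d. is_squarefree_part r d"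
proof -
  obtain a b where ab: "r = of_int a / of_int b" "b > 0"
    using quotient_of_div[of r] quotient_of_denom_pos[of r] by (metis surj_pair)
  define n where "n = a * b"
  have n: "n \<noteq> 0" using assms ab by (auto simp: n_def)
  define d s where "d = squarefree_part n" and "s = square_part n"
  have ds: "d * s ^ 2 = n" "d \<noteq> 0" "s \<noteq> 0" "squarefree d"
    using n squarefree_decompose[of n] by (auto simp: d_def s_def)
  have "r = of_int n / of_int b ^ 2"
    using ab by (simp add: n_def power2_eq_square)
  also have "of_int n = (of_int d * of_int s ^ 2 :: rat)"
    using ds(1) by (metis of_int_mult of_int_power)
  finally have "r / of_int d = (of_int s / of_int b) ^ 2"
    using ds by (simp add: power_divide)
  moreover have "(of_int s / of_int b :: rat) \<noteq> 0" using ds ab by simp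
  ultimately have d: "is_squarefree_part r d"
    using ds unfolding is_squarefree_part_def by blast
  have "e = d" if "is_squarefree_part r e" for e
  proof -
    from d that obtain p q where pq: "p \<noteq> 0" "r / of_int d = p ^ 2"
        "q \<noteq> 0" "r / of_int e = q ^ 2" and e: "squarefree e"
      unfolding is_squarefree_part_def by blast
    have e0: "e \<noteq> 0" using e by auto
    obtain u v where uv: "p / q = of_int u / of_int v" "v > 0" "coprime u v"
      using quotient_of_div[of "p / q"] quotient_of_denom_pos[of "p / q"]
        quotient_of_coprime[of "p / q"] by (metis surj_pair)
    have "of_int e * q ^ 2 = of_int d * p ^ 2"
      using pq(2,4) ds(2) e0 by (simp add: field_simps)
    hence "of_int e = of_int d * (p / q) ^ 2"
      using pq by (simp add: field_simps)
    hence "of_int e * of_int v ^ 2 = (of_int d * of_int u ^ 2 :: rat)"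
      using uv by (simp add: field_simps)
    hence eq: "e * v ^ 2 = d * u ^ 2"
      by (metis of_int_eq_iff of_int_mult of_int_power)
    have cop: "coprime (u ^ 2) (v ^ 2)" using uv(3) by simp
    have "u ^ 2 dvd e" using eq cop by (metis coprime_dvd_mult_left_iff dvd_triv_right)
    hence u: "is_unit u" using e by (auto dest: squarefreeD)
    have "v ^ 2 dvd d" using eq cop
      by (metis coprime_commute coprime_dvd_mult_left_iff dvd_triv_right)
    hence v: "is_unit v" using ds(4) by (auto dest: squarefreeD)
    have "u ^ 2 = 1" "v ^ 2 = 1" using u v by (auto simp: power2_eq_1_iff)
    thus "e = d" using eq by simp
  qed
  with d show ?thesis by blast
qed

end

theory Submission
  imports Defs
begin

text \<open>
  Let \<open>d\<close> be the squarefree part of the discriminant and \<open>d = - 3 c\<close>, so that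
  \<open>m\<close> is \<open>2 \<bar>c\<bar>\<close> or \<open>4 \<bar>c\<bar>\<close> and is prime to 3. A point of
  order dividing \<open>3 m\<close> is a sum of points of order dividing 3 and \<open>m\<close>, so it suffices that
  \<open>K = \<rat>(E[m])\<close> contains \<open>\<zeta>\<^sub>3\<close>, that is, a square root of \<open>- 3 = d /
  c\<close>. Since \<open>m\<close> is even, \<open>K\<close> contains a square root of the discriminant, hence of
  \<open>d\<close>.

  Instead of using the Weil pairing, square roots of the factors of \<open>c\<close> are found among the coordinates
  of torsion points. For odd \<open>n\<close> the product of the ordinates of one point above each root of the
  \<open>n\<close>-th division polynomial is, up to a factor in \<open>\<rat>(E[2 n])\<close>, a square root of
  \<open>(- 1)\<^bsup>(n - 1) / 2\<^esup> n\<close>: its square is the product of the values of that polynomial at the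
  two-torsion abscissae divided by the cube of its leading coefficient \<open>n\<close>, and those values are squares
  up to a common sign. If \<open>e\<close> is a two-torsion abscissa and \<open>x\<close> the abscissa of a point that
  can be halved, then \<open>x - e\<close> is a square; this yields \<open>\<surd>(- 1)\<close> from
  \<open>E[4]\<close> and \<open>\<surd>2\<close> from \<open>E[8]\<close>.
\<close>

section \<open>The group law of a short Weierstrass curve\<close>

locale short_weierstrass =
  fixes a b :: "'a::{alg_closed_field, field_char_0}"
  assumes nonsingular: "4 * a ^ 3 + 27 * b ^ 2 \<noteq> 0"
begin

abbreviation curve :: "'a weierstrass" where
  "curve \<equiv> Weierstrass 0 0 0 a b"

abbreviation add :: "'a point \<Rightarrow> 'a point \<Rightarrow> 'a point"  (infixl "\<oplus>\<^sub>E" 65) where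
  "P \<oplus>\<^sub>E Q \<equiv> point_add curve P Q"

abbreviation neg :: "'a point \<Rightarrow> 'a point"  ("\<ominus>\<^sub>E _" [81] 80) where
  "\<ominus>\<^sub>E P \<equiv> point_neg curve P"

lemma Affine_in_points [simp]: "Affine x y \<in> points curve \<longleftrightarrow> y ^ 2 = x ^ 3 + a * x + b"
  by (auto simp: points_def)

lemma Origin_in_points [simp]: "Origin \<in> points E"
  by (auto simp: points_def)

lemma neg_in_points [simp]: "P \<in> points curve \<Longrightarrow> \<ominus>\<^sub>E P \<in> points curve"
  by (cases P) auto

lemma neg_neg [simp]: "\<ominus>\<^sub>E (\<ominus>\<^sub>E P) = P"
  by (cases P) auto

lemma neg_eq_Origin_iff [simp]: "\<ominus>\<^sub>E P = Origin \<longleftrightarrow> P = Origin"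
  by (cases P) auto

text \<open>The two equations give \<open>a = - 3 * x ^ 2\<close> and \<open>b = 2 * x ^ 3\<close>,
  for which \<open>4 * a ^ 3 + 27 * b ^ 2\<close> cancels.\<close>

lemma no_singular_point: "x ^ 3 + a * x + b = 0 \<Longrightarrow> 3 * x ^ 2 + a \<noteq> 0"
proof
  assume "x ^ 3 + a * x + b = 0" and "3 * x ^ 2 + a = 0"
  then have "a = - (3 * x ^ 2)" and "b = - (x ^ 3 + a * x)"
    by (simp_all add: eq_neg_iff_add_eq_0 algebra_simps)
  then have "4 * a ^ 3 + 27 * b ^ 2 = 0"
    by (simp add: power_mult_distrib power2_eq_square power3_eq_cube algebra_simps)
  with nonsingular show False ..
qed

text \<open>
  \<open>line3 l n x1 x2 x3\<close> says that the line \<open>y = l * x + n\<close> meets the curve exactly above the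
  three abscissae, with multiplicity; it is obtained by comparing coefficients in \<open>x\<^sup>3 + a * x + b - (l *
  x + n)\<^sup>2 = (x - x1) * (x - x2) * (x - x3)\<close>.
\<close>

definition line3 :: "'a \<Rightarrow> 'a \<Rightarrow> 'a \<Rightarrow> 'a \<Rightarrow> 'a \<Rightarrow> bool" where
  "line3 l n x1 x2 x3 \<longleftrightarrow>
     l ^ 2 = x1 + x2 + x3 \<and> a = 2 * l * n + x1 * x2 + x1 * x3 + x2 * x3 \<and> b = n ^ 2 - x1 * x2 * x3"

lemma line3D:
  assumes "line3 l n x1 x2 x3"
  shows "l ^ 2 = x1 + x2 + x3" "a = 2 * l * n + x1 * x2 + x1 * x3 + x2 * x3"
    "b = n ^ 2 - x1 * x2 * x3"
  using assms by (auto simp: line3_def)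

lemma line3_perm:
  assumes "line3 l n x1 x2 x3"
  shows "line3 l n x2 x1 x3" "line3 l n x3 x2 x1" "line3 (- l) (- n) x1 x2 x3"
  using line3D[OF assms] unfolding line3_def by (simp_all add: ac_simps)

lemma line3_eval:
  assumes "line3 l n x1 x2 x3"
  shows "x ^ 3 + a * x + b - (l * x + n) ^ 2 = (x - x1) * (x - x2) * (x - x3)"
  using line3D[OF assms] by Groebner_Basis.algebra

lemma line3_points:
  assumes "line3 l n x1 x2 x3"
  shows "(l * x1 + n) ^ 2 = x1 ^ 3 + a * x1 + b" "(l * x2 + n) ^ 2 = x2 ^ 3 + a * x2 + b"
    "(l * x3 + n) ^ 2 = x3 ^ 3 + a * x3 + b"
  using line3_eval[OF assms, of x1] line3_eval[OF assms, of x2] line3_eval[OF assms, of x3] by auto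

lemma add_Affine:
  assumes "\<not> (x1 = x2 \<and> y1 + y2 = 0)"
    and "l = (if x1 = x2 then (3 * x1 ^ 2 + a) / (2 * y1) else (y2 - y1) / (x2 - x1))"
    and "x3 = l ^ 2 - x1 - x2"
  shows "Affine x1 y1 \<oplus>\<^sub>E Affine x2 y2 = Affine x3 (- (y1 + l * (x3 - x1)))"
  using assms(1) by (auto simp: assms(2,3) Let_def)

lemma add_line3:
  assumes "line3 l n x1 x2 x3" "y1 = l * x1 + n" "y2 = l * x2 + n" "x1 \<noteq> x2 \<or> y2 \<noteq> 0"
  shows "Affine x1 y1 \<oplus>\<^sub>E Affine x2 y2 = Affine x3 (- (l * x3 + n))"
proof -
  define m where "m = (if x1 = x2 then (3 * x1 ^ 2 + a) / (2 * y1) else (y2 - y1) / (x2 - x1))"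
  have "m = l"
  proof (cases "x1 = x2")
    case True
    \<comment> \<open>With a double abscissa the line is a tangent: this is the derivative of
      \<open>line3_eval\<close> at \<open>x1\<close>.\<close>
    have "3 * x1 ^ 2 + a = l * (2 * y1)"
      using line3D[OF assms(1)] assms(2) True by Groebner_Basis.algebra
    moreover have "y1 = y2"
      using True assms by simp
    then have "2 * y1 \<noteq> 0"
      using True assms(4) by simp
    ultimately have "(3 * x1 ^ 2 + a) / (2 * y1) = l"
      by (metis nonzero_eq_divide_eq)
    with True show ?thesis by (simp add: m_def)
  next
    case False
    then show ?thesis by (simp add: m_def assms(2,3) field_simps)
  qed
  moreover have "\<not> (x1 = x2 \<and> y1 + y2 = 0)"
  proof
    assume "x1 = x2 \<and> y1 + y2 = 0"
    moreover from this have "y1 = y2"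
      using assms(2,3) by simp
    ultimately show False
      using assms(4) by simp
  qed
  moreover have "x3 = l ^ 2 - x1 - x2"
    using assms(1) by (simp add: line3_def)
  ultimately have "Affine x1 y1 \<oplus>\<^sub>E Affine x2 y2 = Affine x3 (- (y1 + l * (x3 - x1)))"
    by (intro add_Affine) (simp_all flip: m_def)
  then show ?thesis
    by (simp add: assms(2) algebra_simps)
qed

lemma same_abscissa:
  assumes "Affine x y \<in> points curve" "Affine x y' \<in> points curve"
  shows "y' = y \<or> y' = - y"
  using assms by (metis Affine_in_points power2_eq_iff)

text \<open>Turns the slope formula into the polynomial relations \<open>line3\<close>, so that
  later identities become questions of ideal membership.\<close>

lemma obtain_line3:
  assumes "Affine x1 y1 \<in> points curve" "Affine x2 y2 \<in> points curve" "\<not> (x1 = x2 \<and> y1 + y2 = 0)"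
  obtains l n x3 where "line3 l n x1 x2 x3" "y1 = l * x1 + n" "y2 = l * x2 + n"
    "Affine x1 y1 \<oplus>\<^sub>E Affine x2 y2 = Affine x3 (- (l * x3 + n))"
proof -
  define l where "l = (if x1 = x2 then (3 * x1 ^ 2 + a) / (2 * y1) else (y2 - y1) / (x2 - x1))"
  define n where "n = y1 - l * x1"
  define x3 where "x3 = l ^ 2 - x1 - x2"
  have on: "y1 ^ 2 = x1 ^ 3 + a * x1 + b" "y2 ^ 2 = x2 ^ 3 + a * x2 + b"
    using assms by auto
  have y2: "y2 = l * x2 + n" and y: "x1 \<noteq> x2 \<or> y2 \<noteq> 0" and line: "line3 l n x1 x2 x3"
  proof -
    have "y2 = l * x2 + n \<and> (x1 \<noteq> x2 \<or> y2 \<noteq> 0) \<and> line3 l n x1 x2 x3"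
    proof (cases "x1 = x2")
      case True
      then have "y2 = y1" "y1 \<noteq> 0"
        using assms same_abscissa[of x1 y1 y2] by auto
      moreover from this have "l * (2 * y1) = 3 * x1 ^ 2 + a"
        using True by (simp add: l_def)
      moreover from this have "a = 2 * l * n + x1 * x1 + x1 * x3 + x1 * x3"
        using True unfolding x3_def n_def by Groebner_Basis.algebra
      moreover from this have "b = n ^ 2 - x1 * x1 * x3"
        using True on(1) unfolding x3_def n_def by Groebner_Basis.algebra
      moreover have "l ^ 2 = x1 + x1 + x3"
        by (simp add: x3_def True)
      ultimately show ?thesis
        unfolding True[symmetric] line3_def by (auto simp: n_def)
    next
      case False
      then have l: "l * (x2 - x1) = y2 - y1"
        by (simp add: l_def)
      then have y2: "y2 = l * x2 + n"
        by (simp add: n_def algebra_simps)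
      \<comment> \<open>This is the difference of the two curve equations; the factor
        \<open>x2 - x1\<close> is cancelled next.\<close>
      have "(x2 - x1) * (a - (2 * l * n + x1 * x2 + x1 * x3 + x2 * x3)) = 0"
        using l on unfolding x3_def n_def by Groebner_Basis.algebra
      then have "a = 2 * l * n + x1 * x2 + x1 * x3 + x2 * x3"
        using False by simp
      moreover from this have "b = n ^ 2 - x1 * x2 * x3"
        using on unfolding x3_def n_def by Groebner_Basis.algebra
      moreover have "l ^ 2 = x1 + x2 + x3"
        by (simp add: x3_def)
      ultimately show ?thesis
        using False y2 unfolding line3_def by blast
    qed
    then show "y2 = l * x2 + n" "x1 \<noteq> x2 \<or> y2 \<noteq> 0" "line3 l n x1 x2 x3" by auto
  qed
  show ?thesis
    using that[OF line _ y2] add_line3[OF line _ y2 y] by (auto simp: n_def)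
qed

lemma add_in_points [simp]:
  assumes "P \<in> points curve" "Q \<in> points curve"
  shows "P \<oplus>\<^sub>E Q \<in> points curve"
proof (cases P; cases Q)
  fix x1 y1 x2 y2 assume PQ: "P = Affine x1 y1" "Q = Affine x2 y2"
  show ?thesis
  proof (cases "x1 = x2 \<and> y1 + y2 = 0")
    case False
    with assms PQ obtain l n x3 where "line3 l n x1 x2 x3" "P \<oplus>\<^sub>E Q = Affine x3 (- (l * x3 + n))"
      using obtain_line3[of x1 y1 x2 y2] by metis
    then show ?thesis
      using line3_points(3) by (metis Affine_in_points power2_minus)
  qed (use PQ in auto)
qed (use assms in auto)

lemma add_commute:
  assumes "P \<in> points curve" "Q \<in> points curve"
  shows "P \<oplus>\<^sub>E Q = Q \<oplus>\<^sub>E P"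
proof (cases P; cases Q)
  fix x1 y1 x2 y2 assume PQ: "P = Affine x1 y1" "Q = Affine x2 y2"
  show ?thesis
  proof (cases "x1 = x2 \<and> y1 + y2 = 0")
    case False
    with assms PQ obtain l n x3 where line: "line3 l n x1 x2 x3" "y1 = l * x1 + n" "y2 = l * x2 + n"
       "P \<oplus>\<^sub>E Q = Affine x3 (- (l * x3 + n))"
      using obtain_line3[of x1 y1 x2 y2] by metis
    moreover have "x2 \<noteq> x1 \<or> y1 \<noteq> 0"
      using False line(2,3) by (metis add_0)
    ultimately show ?thesis
      using add_line3[OF line3_perm(1)[OF line(1)] line(3,2)] PQ by simp
  qed (use PQ in \<open>auto simp: add.commute\<close>)
qed (use assms in auto)

lemma add_Origin_right [simp]: "P \<oplus>\<^sub>E Origin = P"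
  by (cases P) auto

lemma add_neg_right [simp]: "P \<oplus>\<^sub>E \<ominus>\<^sub>E P = Origin"
  by (cases P) auto

lemma add_neg_left [simp]: "\<ominus>\<^sub>E P \<oplus>\<^sub>E P = Origin"
  by (cases P) auto

text \<open>Reflecting the line through \<open>P\<close> and \<open>Q\<close> gives a line through
  \<open>P \<oplus>\<^sub>E Q\<close>, \<open>\<ominus>\<^sub>E Q\<close> and
  \<open>\<ominus>\<^sub>E P\<close>, so the same relation \<open>line3\<close>, read in another
  order, computes the sum. This special case of associativity is an ingredient of the general
  one.\<close>

lemma add_neg_cancel:
  assumes "P \<in> points curve" "Q \<in> points curve"
  shows "(P \<oplus>\<^sub>E Q) \<oplus>\<^sub>E \<ominus>\<^sub>E Q = P"
proof (cases P; cases Q)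
  fix x1 y1 x2 y2 assume PQ: "P = Affine x1 y1" "Q = Affine x2 y2"
  show ?thesis
  proof (cases "x1 = x2 \<and> y1 + y2 = 0")
    case True
    then have "P = \<ominus>\<^sub>E Q"
      using PQ by (simp add: eq_neg_iff_add_eq_0)
    then show ?thesis by simp
  next
    case False
    with assms PQ obtain l n x3 where line: "line3 l n x1 x2 x3" "y1 = l * x1 + n" "y2 = l * x2 + n"
       "P \<oplus>\<^sub>E Q = Affine x3 (- (l * x3 + n))"
      using obtain_line3[of x1 y1 x2 y2] by metis
    \<comment> \<open>The reflected line could only fail as a tangent at a two-torsion point; a
      tangent of finite slope there would make the point singular.\<close>
    have "x3 \<noteq> x2 \<or> - y2 \<noteq> 0"
    proof (rule ccontr)
      assume "\<not> ?thesis"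
      then have "x3 = x2" "y2 = 0" by auto
      have "3 * x2 ^ 2 + a = 0"
        using line3D[OF line(1)] line(3) \<open>y2 = 0\<close> \<open>x3 = x2\<close> by Groebner_Basis.algebra
      with \<open>y2 = 0\<close> show False
        using no_singular_point[of x2] assms PQ by auto
    qed
    with line show ?thesis
      using add_line3[of "- l" "- n" x3 x2 x1 "- (l * x3 + n)" "- y2"]
        line3_perm(3)[OF line3_perm(2)] PQ by auto
  qed
qed (use assms in auto)

lemma add_neg_cancel':
  assumes "P \<in> points curve" "Q \<in> points curve"
  shows "(P \<oplus>\<^sub>E \<ominus>\<^sub>E Q) \<oplus>\<^sub>E Q = P"
  using add_neg_cancel[of P "\<ominus>\<^sub>E Q"] assms by simp

section \<open>Associativity of the addition\<close>

text \<open>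
  In the notation of the lemma, the function \<open>(x - x1) * (x - x2) - (l + m) * (y - (l * x + n))\<close> vanishes
  at the points above \<open>x1\<close>, \<open>x2\<close> of the first line and at those above \<open>x4\<close>,
  \<open>x5\<close> of the second line. Associativity comes from its being determined by three of these four points.
\<close>

lemma line3_line3:
  assumes "line3 l n x1 x2 x3" "line3 m k x3 x4 x5" "m * x3 + k = - (l * x3 + n)"
  shows "(l + m) * ((m * x + k) - (l * x + n)) = (x - x1) * (x - x2) - (x - x4) * (x - x5)"
  using line3D[OF assms(1)] line3D[OF assms(2)] assms(3) by Groebner_Basis.algebra

text \<open>The two bracketings give two such functions through the same three points, above
  \<open>x1\<close>, \<open>x2\<close> and \<open>x4\<close>. The functions coincide, hence so do
  their fourth zeros, above \<open>x5\<close> and \<open>x7\<close>.\<close>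

lemma add_assoc_chord:
  assumes P: "Affine x1 y1 \<in> points curve" and Q: "Affine x2 y2 \<in> points curve"
    and S: "Affine x4 y4 \<in> points curve" and ne: "x1 \<noteq> x2" "x4 \<noteq> x1" "x4 \<noteq> x2"
    and PQ: "Affine x1 y1 \<oplus>\<^sub>E Affine x2 y2 = Affine x3 y3" "x3 \<noteq> x4"
    and QS: "Affine x2 y2 \<oplus>\<^sub>E Affine x4 y4 = Affine x6 y6" "x6 \<noteq> x1"
  shows "(Affine x1 y1 \<oplus>\<^sub>E Affine x2 y2) \<oplus>\<^sub>E Affine x4 y4 =
    Affine x1 y1 \<oplus>\<^sub>E (Affine x2 y2 \<oplus>\<^sub>E Affine x4 y4)"
proof -
  obtain l n where l: "line3 l n x1 x2 x3" "y1 = l * x1 + n" "y2 = l * x2 + n" "y3 = - (l * x3 + n)"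
    using obtain_line3[OF P Q] ne PQ by (metis point.inject)
  obtain m k where m: "line3 m k x2 x4 x6" "y2 = m * x2 + k" "y4 = m * x4 + k" "y6 = - (m * x6 + k)"
    using obtain_line3[OF Q S] ne QS by (metis point.inject)
  have R: "Affine x3 y3 \<in> points curve" "Affine x6 y6 \<in> points curve"
    using add_in_points P Q S PQ QS by metis+
  obtain l' n' x5 where l': "line3 l' n' x3 x4 x5" "y3 = l' * x3 + n'" "y4 = l' * x4 + n'"
      "Affine x3 y3 \<oplus>\<^sub>E Affine x4 y4 = Affine x5 (- (l' * x5 + n'))"
    using obtain_line3[OF R(1) S] PQ by metis
  obtain m' k' x7 where m': "line3 m' k' x6 x1 x7" "y6 = m' * x6 + k'" "y1 = m' * x1 + k'"
      "Affine x6 y6 \<oplus>\<^sub>E Affine x1 y1 = Affine x7 (- (m' * x7 + k'))"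
    using obtain_line3[OF R(2) P] QS by metis
  note h = line3_line3[OF l(1) l'(1)] and h' = line3_line3[OF m(1) m'(1)]
  have hyp: "l' * x3 + n' = - (l * x3 + n)" "m' * x6 + k' = - (m * x6 + k)"
    using l l' m m' by auto
  have h4: "(l + l') * (y4 - (l * x4 + n)) = (x4 - x1) * (x4 - x2)"
    using h[OF hyp(1), of x4] l' by simp
  have h5: "(l + l') * ((l' * x5 + n') - (l * x5 + n)) = (x5 - x1) * (x5 - x2)"
    using h[OF hyp(1), of x5] by simp
  have h1: "(m + m') * (y1 - (m * x1 + k)) = (x1 - x2) * (x1 - x4)"
    using h'[OF hyp(2), of x1] m' by simp
  have h7: "(m + m') * ((m' * x7 + k') - (m * x7 + k)) = (x7 - x2) * (x7 - x4)"
    using h'[OF hyp(2), of x7] by simp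
  have nz: "l + l' \<noteq> 0"
    using h4 ne by auto
  have ncol: "y4 - (l * x4 + n) \<noteq> 0"
    using h4 ne by auto
  have "(l - m) * (x2 - x1) = - (y1 - (m * x1 + k))"
    using l(2,3) m(2,3) by Groebner_Basis.algebra
  moreover have "(m - l) * (x4 - x2) = y4 - (l * x4 + n)"
    using l(2,3) m(2,3) by Groebner_Basis.algebra
  ultimately have "(x4 - x2) * (y1 - (m * x1 + k)) = (x2 - x1) * (y4 - (l * x4 + n))"
    by Groebner_Basis.algebra
  then have "(x4 - x2) * ((m + m') * (y1 - (m * x1 + k))) = (m + m') * ((x2 - x1) * (y4 - (l * x4 + n)))"
    by Groebner_Basis.algebra
  then have "(x2 - x1) * ((m + m') * (y4 - (l * x4 + n))) = (x2 - x1) * ((x4 - x2) * (x4 - x1))"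
    unfolding h1 by Groebner_Basis.algebra
  then have "(m + m') * (y4 - (l * x4 + n)) = (l + l') * (y4 - (l * x4 + n))"
    using ne h4 by simp
  \<comment> \<open>The coefficients of the ordinate in the two functions agree; \<open>lm\<close>
    below expresses the same for the coefficients of the abscissa.\<close>
  then have g: "m + m' = l + l'"
    using ncol by simp
  have lm: "(l + l') * (m - l) = x4 - x1"
  proof -
    have "(x4 - x2) * ((l + l') * (m - l)) = (x4 - x2) * (x4 - x1)"
      using h4 \<open>(m - l) * (x4 - x2) = y4 - (l * x4 + n)\<close> by Groebner_Basis.algebra
    with ne show ?thesis by simp
  qed
  have x: "x5 = x7"
  proof -
    have "x5 = l' ^ 2 - l ^ 2 + x1 + x2 - x4" "x7 = m' ^ 2 - m ^ 2 + x2 + x4 - x1"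
      using line3D(1)[OF l(1)] line3D(1)[OF l'(1)] line3D(1)[OF m(1)] line3D(1)[OF m'(1)] by Groebner_Basis.algebra+
    then show ?thesis
      using g lm by Groebner_Basis.algebra
  qed
  have "(l + l') * (l' * x5 + n') = (l + l') * (m' * x7 + k')"
    using h5 h7 g lm x l(2,3) m(2,3) by Groebner_Basis.algebra
  then have "l' * x5 + n' = m' * x7 + k'"
    using nz by simp
  then show ?thesis
    using PQ QS l'(4) m'(4) x add_commute[OF P R(2)] by simp
qed

text \<open>The case \<open>P = Q\<close> of the preceding argument: passing through two points
  becomes vanishing twice at \<open>P\<close>.\<close>

lemma add_assoc_tangent:
  assumes P: "Affine x1 y1 \<in> points curve" and S: "Affine x4 y4 \<in> points curve"
    and ne: "y1 \<noteq> 0" "x4 \<noteq> x1"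
    and PP: "Affine x1 y1 \<oplus>\<^sub>E Affine x1 y1 = Affine x3 y3" "x3 \<noteq> x4"
    and PS: "Affine x1 y1 \<oplus>\<^sub>E Affine x4 y4 = Affine x6 y6" "x6 \<noteq> x1"
  shows "(Affine x1 y1 \<oplus>\<^sub>E Affine x1 y1) \<oplus>\<^sub>E Affine x4 y4 =
    Affine x1 y1 \<oplus>\<^sub>E (Affine x1 y1 \<oplus>\<^sub>E Affine x4 y4)"
proof -
  obtain l n where l: "line3 l n x1 x1 x3" "y1 = l * x1 + n" "y3 = - (l * x3 + n)"
  proof (rule obtain_line3[OF P P])
    show "\<not> (x1 = x1 \<and> y1 + y1 = 0)"
      using ne by auto
  qed (use PP that in auto)
  obtain m k where m: "line3 m k x1 x4 x6" "y1 = m * x1 + k" "y4 = m * x4 + k" "y6 = - (m * x6 + k)"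
    using obtain_line3[OF P S] ne PS by (metis point.inject)
  have R: "Affine x3 y3 \<in> points curve" "Affine x6 y6 \<in> points curve"
    using add_in_points P S PP PS by metis+
  obtain l' n' x5 where l': "line3 l' n' x3 x4 x5" "y3 = l' * x3 + n'" "y4 = l' * x4 + n'"
      "Affine x3 y3 \<oplus>\<^sub>E Affine x4 y4 = Affine x5 (- (l' * x5 + n'))"
    using obtain_line3[OF R(1) S] PP by metis
  obtain m' k' x7 where m': "line3 m' k' x6 x1 x7" "y6 = m' * x6 + k'" "y1 = m' * x1 + k'"
      "Affine x6 y6 \<oplus>\<^sub>E Affine x1 y1 = Affine x7 (- (m' * x7 + k'))"
    using obtain_line3[OF R(2) P] PS by metis
  note h = line3_line3[OF l(1) l'(1)] and h' = line3_line3[OF m(1) m'(1)]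
  have hyp: "l' * x3 + n' = - (l * x3 + n)" "m' * x6 + k' = - (m * x6 + k)"
    using l l' m m' by auto
  have h4: "(l + l') * (y4 - (l * x4 + n)) = (x4 - x1) * (x4 - x1)"
    using h[OF hyp(1), of x4] l' by simp
  have h5: "(l + l') * ((l' * x5 + n') - (l * x5 + n)) = (x5 - x1) * (x5 - x1)"
    using h[OF hyp(1), of x5] by simp
  have h7: "(m + m') * ((m' * x7 + k') - (m * x7 + k)) = (x7 - x1) * (x7 - x4)"
    using h'[OF hyp(2), of x7] by simp
  have nz: "l + l' \<noteq> 0"
    using h4 ne by auto
  have lm: "(l + l') * (m - l) = x4 - x1"
  proof -
    have "(m - l) * (x4 - x1) = y4 - (l * x4 + n)"
      using l(2,3) m(2,3) by Groebner_Basis.algebra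
    then have "(x4 - x1) * ((l + l') * (m - l)) = (x4 - x1) * (x4 - x1)"
      using h4 by Groebner_Basis.algebra
    with ne show ?thesis by simp
  qed
  \<comment> \<open>Evaluation at \<open>x1\<close>, as used for distinct points, would read
    \<open>0 = 0\<close> here; the tangent at \<open>x1\<close> supplies the missing
    condition.\<close>
  have "2 * y1 * (l - m) = (x4 - x1) * (x6 - x1)"
    using line3D[OF l(1)] line3D[OF m(1)] l(2) m(2) by Groebner_Basis.algebra
  moreover have "(m + m') * (x6 - x1) = - 2 * y1"
    using m(2,4) m'(2,3) by Groebner_Basis.algebra
  ultimately have "(x6 - x1) * ((m + m') * (m - l)) = (x6 - x1) * (x4 - x1)"
    by Groebner_Basis.algebra
  then have "(m + m') * (m - l) = (l + l') * (m - l)"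
    using PS lm by simp
  then have g: "m + m' = l + l'"
    using lm ne by (metis eq_iff_diff_eq_0 mult_right_cancel mult_zero_right)
  have x: "x5 = x7"
  proof -
    have "x5 = l' ^ 2 - l ^ 2 + x1 + x1 - x4" "x7 = m' ^ 2 - m ^ 2 + x1 + x4 - x1"
      using line3D(1)[OF l(1)] line3D(1)[OF l'(1)] line3D(1)[OF m(1)] line3D(1)[OF m'(1)] by Groebner_Basis.algebra+
    then show ?thesis
      using g lm by Groebner_Basis.algebra
  qed
  have "(l + l') * (l' * x5 + n') = (l + l') * (m' * x7 + k')"
    using h5 h7 g lm x l(2) m(2,3) by Groebner_Basis.algebra
  then have "l' * x5 + n' = m' * x7 + k'"
    using nz by simp
  then show ?thesis
    using PP PS l'(4) m'(4) x add_commute[OF P R(2)] by simp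
qed

lemma Affine_cases_same_abscissa:
  assumes "Affine x y \<in> points curve" "Affine x y' \<in> points curve"
  shows "Affine x y' = Affine x y \<or> Affine x y' = \<ominus>\<^sub>E Affine x y"
  using same_abscissa[OF assms] by auto

lemma eq_add_negI:
  assumes "P \<in> points curve" "Q \<in> points curve" "Q \<oplus>\<^sub>E P = R"
  shows "P = R \<oplus>\<^sub>E \<ominus>\<^sub>E Q"
  using add_neg_cancel[of P Q] add_commute[of P Q] assms by auto

text \<open>Associativity holds for a generic third point; moving by such a point gives it in general.\<close>

lemma finite_not_assoc:
  assumes P: "P \<in> points curve" and Q: "Q \<in> points curve"
  shows "finite {S \<in> points curve. (P \<oplus>\<^sub>E Q) \<oplus>\<^sub>E S \<noteq> P \<oplus>\<^sub>E (Q \<oplus>\<^sub>E S)}"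
proof -
  \<comment> \<open>Each listed point rules out a coincidence: \<open>S\<close> above
    \<open>x1\<close>, \<open>x2\<close> or the abscissa of \<open>P \<oplus>\<^sub>E Q\<close>, or
    \<open>Q \<oplus>\<^sub>E S\<close> equal to \<open>Origin\<close>, \<open>P\<close> or
    \<open>\<ominus>\<^sub>E P\<close>.\<close>
  define B where "B = {Origin, P, \<ominus>\<^sub>E P, Q, \<ominus>\<^sub>E Q, P \<oplus>\<^sub>E Q, \<ominus>\<^sub>E (P \<oplus>\<^sub>E Q), P \<oplus>\<^sub>E \<ominus>\<^sub>E Q, \<ominus>\<^sub>E P \<oplus>\<^sub>E \<ominus>\<^sub>E Q}"
  have "(P \<oplus>\<^sub>E Q) \<oplus>\<^sub>E S = P \<oplus>\<^sub>E (Q \<oplus>\<^sub>E S)" if S: "S \<in> points curve" "S \<notin> B" for S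
  proof (cases "P = Origin \<or> Q = Origin \<or> Q = \<ominus>\<^sub>E P")
    case True
    moreover have "P \<oplus>\<^sub>E (\<ominus>\<^sub>E P \<oplus>\<^sub>E S) = S"
      using add_neg_cancel'[OF S(1) P] P S(1) by (metis add_commute add_in_points neg_in_points)
    ultimately show ?thesis by auto
  next
    case False
    obtain x1 y1 x2 y2 x4 y4 where eq: "P = Affine x1 y1" "Q = Affine x2 y2" "S = Affine x4 y4"
      using False S by (cases P; cases Q; cases S) (auto simp: B_def)
    have x4: "x4 \<noteq> x1" "x4 \<noteq> x2"
      using S P Q Affine_cases_same_abscissa[of x4] unfolding eq B_def by blast+
    have PQ0: "P \<oplus>\<^sub>E Q \<noteq> Origin"
    proof
      assume "P \<oplus>\<^sub>E Q = Origin"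
      from eq_add_negI[OF Q P this] False show False by simp
    qed
    then obtain x3 y3 where PQ: "P \<oplus>\<^sub>E Q = Affine x3 y3"
      by (cases "P \<oplus>\<^sub>E Q") auto
    have x3: "x3 \<noteq> x4"
      using Affine_cases_same_abscissa[of x3 y3 y4] add_in_points[OF P Q] S PQ
      unfolding eq(3) B_def by auto
    have QS0: "Q \<oplus>\<^sub>E S \<noteq> R" if "R \<in> {Origin, P, \<ominus>\<^sub>E P}" for R
    proof
      assume "Q \<oplus>\<^sub>E S = R"
      from eq_add_negI[OF S(1) Q this] that S(2) show False by (auto simp: B_def)
    qed
    then obtain x6 y6 where QS: "Q \<oplus>\<^sub>E S = Affine x6 y6"
      by (cases "Q \<oplus>\<^sub>E S") auto
    have x6: "x6 \<noteq> x1"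
      using Affine_cases_same_abscissa[of x1 y1 y6] add_in_points[OF Q S(1)] P QS QS0[of "Affine x6 y6"]
      unfolding eq by auto
    show ?thesis
    proof (cases "x1 = x2")
      case True
      then have "P = Q"
        using Affine_cases_same_abscissa[of x1 y1 y2] False P Q unfolding eq by auto
      moreover have "y1 \<noteq> 0"
        using PQ0 eq \<open>P = Q\<close> by auto
      ultimately show ?thesis
        using add_assoc_tangent[of x1 y1 x4 y4 x3 y3 x6 y6] eq x4 x3 x6 P S PQ QS by auto
    next
      case False
      then show ?thesis
        using add_assoc_chord[of x1 y1 x2 y2 x4 y4 x3 y3 x6 y6] eq x4 x3 x6 P Q S PQ QS by auto
    qed
  qed
  then have "{S \<in> points curve. (P \<oplus>\<^sub>E Q) \<oplus>\<^sub>E S \<noteq> P \<oplus>\<^sub>E (Q \<oplus>\<^sub>E S)} \<subseteq> B"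
    by blast
  moreover have "finite B"
    by (simp add: B_def)
  ultimately show ?thesis
    by (rule finite_subset)
qed

lemma exists_point_above: "\<exists>y. Affine x y \<in> points curve"
  using nth_root_exists[of 2 "x ^ 3 + a * x + b"] by auto

lemma infinite_points: "infinite (points curve)"
proof
  assume "finite (points curve)"
  moreover have "UNIV \<subseteq> (\<lambda>P. case P of Affine x y \<Rightarrow> x | Origin \<Rightarrow> 0) ` points curve"
  proof
    fix x :: 'a
    obtain y where "Affine x y \<in> points curve"
      using exists_point_above by blast
    then show "x \<in> (\<lambda>P. case P of Affine x y \<Rightarrow> x | Origin \<Rightarrow> 0) ` points curve"
      by (rule rev_image_eqI) simp
  qed
  ultimately have "finite (UNIV :: 'a set)"
    by (meson finite_imageI finite_subset)
  then show False
    using infinite_UNIV_char_0 by blast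
qed

theorem add_assoc:
  assumes P: "P \<in> points curve" and Q: "Q \<in> points curve" and S: "S \<in> points curve"
  shows "(P \<oplus>\<^sub>E Q) \<oplus>\<^sub>E S = P \<oplus>\<^sub>E (Q \<oplus>\<^sub>E S)"
proof -
  define bad where "bad P Q = {S \<in> points curve. (P \<oplus>\<^sub>E Q) \<oplus>\<^sub>E S \<noteq> P \<oplus>\<^sub>E (Q \<oplus>\<^sub>E S)}" for P Q
  \<comment> \<open>Writing sums as products, the chain is
    \<open>((PQ)S)T = (PQ)(ST) = P(Q(ST)) = P((QS)T) = (P(QS))T\<close>, after which
    \<open>T\<close> is cancelled. Each equality excludes finitely many \<open>T\<close>; the image
    set is for the one with third point \<open>ST\<close>.\<close>
  define B where "B = bad (P \<oplus>\<^sub>E Q) S \<union> (\<lambda>Y. Y \<oplus>\<^sub>E \<ominus>\<^sub>E S) ` bad P Q \<union> bad Q S \<union> bad P (Q \<oplus>\<^sub>E S)"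
  have "finite B"
    using P Q S by (auto simp: bad_def B_def intro!: finite_not_assoc)
  then obtain T where T: "T \<in> points curve" "T \<notin> B"
    using infinite_points by (meson finite_subset subsetI)
  have "S \<oplus>\<^sub>E T \<notin> bad P Q"
    using T eq_add_negI[of T S "S \<oplus>\<^sub>E T"] S by (auto simp: B_def)
  then have "((P \<oplus>\<^sub>E Q) \<oplus>\<^sub>E S) \<oplus>\<^sub>E T = (P \<oplus>\<^sub>E (Q \<oplus>\<^sub>E S)) \<oplus>\<^sub>E T"
    using T P Q S by (auto simp: bad_def B_def)
  then show ?thesis
    using add_neg_cancel[OF _ T(1)] P Q S by (metis add_in_points)
qed

section \<open>Multiples of points and torsion\<close>

abbreviation mult :: "nat \<Rightarrow> 'a point \<Rightarrow> 'a point" where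
  "mult n P \<equiv> nat_mult curve n P"

lemma mult_0 [simp]: "mult 0 P = Origin"
  by (simp add: nat_mult_def)

lemma mult_Suc: "mult (Suc n) P = P \<oplus>\<^sub>E mult n P"
  by (simp add: nat_mult_def)

lemma mult_1 [simp]: "mult (Suc 0) P = P"
  by (simp add: mult_Suc)

lemma mult_in_points [simp]: "P \<in> points curve \<Longrightarrow> mult n P \<in> points curve"
  by (induction n) (simp_all add: mult_Suc)

lemma mult_Origin [simp]: "mult n Origin = Origin"
  by (induction n) (simp_all add: mult_Suc)

lemma mult_add: "P \<in> points curve \<Longrightarrow> mult (m + n) P = mult m P \<oplus>\<^sub>E mult n P"
  by (induction m) (simp_all add: mult_Suc add_assoc)

lemma mult_mult: "P \<in> points curve \<Longrightarrow> mult (m * n) P = mult m (mult n P)"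
  by (induction m) (simp_all add: mult_Suc mult_add)

lemma torsion_dvd_mono:
  assumes "m dvd n"
  shows "torsion curve m \<subseteq> torsion curve n"
proof -
  obtain k where "n = k * m"
    using assms by (metis dvdE mult.commute)
  then show ?thesis
    by (auto simp: torsion_def mult_mult)
qed

end

section \<open>Multiplication on abscissae\<close>

text \<open>
  \<open>xmult a b x n\<close> is a pair \<open>(A, B)\<close> such that \<open>A / B\<close> is the abscissa of the
  \<open>n\<close>-th multiple of a point with abscissa \<open>x\<close> (the point at infinity for \<open>B =
  0\<close>), in terms of field elements or of the generic abscissa in the polynomial ring. In the odd case, the
  abscissae of \<open>Q + R\<close> and \<open>Q - R\<close> have a simple sum, and the second one is \<open>x\<close>
  for consecutive multiples \<open>Q\<close>, \<open>R\<close>.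
\<close>

function xmult :: "'r::comm_ring_1 \<Rightarrow> 'r \<Rightarrow> 'r \<Rightarrow> nat \<Rightarrow> 'r \<times> 'r" where
  "xmult a b x n =
    (if n = 0 then (1, 0) else if n = 1 then (x, 1) else
     case xmult a b x (n div 2) of (A, B) \<Rightarrow>
       if even n then ((A ^ 2 - a * B ^ 2) ^ 2 - 8 * b * A * B ^ 3, 4 * B * (A ^ 3 + a * A * B ^ 2 + b * B ^ 3))
       else case xmult a b x (Suc (n div 2)) of (A', B') \<Rightarrow>
         (2 * ((A * B' + A' * B) * (A * A' + a * B * B') + 2 * b * B ^ 2 * B' ^ 2) - x * (A * B' - A' * B) ^ 2,
          (A * B' - A' * B) ^ 2))"
  by auto
termination
  by (relation "measure (\<lambda>(a, b, x, n). n)") (auto elim!: oddE)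

declare xmult.simps [simp del]

abbreviation xnum :: "'r::comm_ring_1 \<Rightarrow> 'r \<Rightarrow> 'r \<Rightarrow> nat \<Rightarrow> 'r" where
  "xnum a b x n \<equiv> fst (xmult a b x n)"

abbreviation xden :: "'r::comm_ring_1 \<Rightarrow> 'r \<Rightarrow> 'r \<Rightarrow> nat \<Rightarrow> 'r" where
  "xden a b x n \<equiv> snd (xmult a b x n)"

text \<open>Up to sign, the division polynomial of index \<open>2 * k + 1\<close>.\<close>

definition divpol :: "'r::comm_ring_1 \<Rightarrow> 'r \<Rightarrow> 'r \<Rightarrow> nat \<Rightarrow> 'r" where
  "divpol a b x k = xnum a b x k * xden a b x (Suc k) - xnum a b x (Suc k) * xden a b x k"

lemma xmult_0 [simp]: "xmult a b x 0 = (1, 0)"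
  by (simp add: xmult.simps)

lemma xmult_1 [simp]: "xmult a b x (Suc 0) = (x, 1)"
  by (simp add: xmult.simps)

lemma xmult_double:
  "xnum a b x (2 * k) = (xnum a b x k ^ 2 - a * xden a b x k ^ 2) ^ 2 - 8 * b * xnum a b x k * xden a b x k ^ 3"
  "xden a b x (2 * k) =
    4 * xden a b x k * (xnum a b x k ^ 3 + a * xnum a b x k * xden a b x k ^ 2 + b * xden a b x k ^ 3)"
  by (subst xmult.simps; cases "k = 0"; simp add: case_prod_beta)+

lemma xden_odd: "xden a b x (Suc (2 * k)) = divpol a b x k ^ 2"
  by (subst xmult.simps; cases "k = 0"; simp add: case_prod_beta divpol_def)

lemma xnum_odd:
  "xnum a b x (Suc (2 * k)) =
    2 * ((xnum a b x k * xden a b x (Suc k) + xnum a b x (Suc k) * xden a b x k) *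
         (xnum a b x k * xnum a b x (Suc k) + a * xden a b x k * xden a b x (Suc k)) +
         2 * b * xden a b x k ^ 2 * xden a b x (Suc k) ^ 2) - x * divpol a b x k ^ 2"
  by (subst xmult.simps; cases "k = 0"; simp add: case_prod_beta divpol_def)

text \<open>Follows the recursion of \<open>xmult\<close>; \<open>k > 0\<close> makes
  \<open>Suc k\<close> smaller than \<open>Suc (2 * k)\<close>.\<close>

lemma double_induct [case_names 0 1 even odd]:
  assumes "P 0" "P 1" "\<And>k. k > 0 \<Longrightarrow> P k \<Longrightarrow> P (2 * k)"
    "\<And>k. k > 0 \<Longrightarrow> P k \<Longrightarrow> P (Suc k) \<Longrightarrow> P (Suc (2 * k))"
  shows "P (n::nat)"
proof (induction n rule: less_induct)
  case (less n)
  consider "n = 0" | "n = 1" | k where "n = 2 * k" "k > 0" | k where "n = Suc (2 * k)" "k > 0"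
    by (metis One_nat_def gr0I mult_0_right oddE Suc_eq_plus1 evenE)
  then show ?case
    by cases (use assms less in auto)
qed

section \<open>Correctness of the abscissa formulas\<close>

context short_weierstrass
begin

text \<open>The pair is a point of the projective line: with \<open>A \<noteq> 0\<close> at
  \<open>Origin\<close>, numerator and denominator never vanish together.\<close>

fun abscissa_rep :: "'a point \<Rightarrow> 'a \<times> 'a \<Rightarrow> bool" where
  "abscissa_rep Origin (A, B) \<longleftrightarrow> A \<noteq> 0 \<and> B = 0"
| "abscissa_rep (Affine x y) (A, B) \<longleftrightarrow> B \<noteq> 0 \<and> A = x * B"

lemma abscissa_double:
  assumes "Affine x y \<in> points curve" "y \<noteq> 0"
  obtains u v where "Affine x y \<oplus>\<^sub>E Affine x y = Affine u v" "u * (4 * y ^ 2) = (x ^ 2 - a) ^ 2 - 8 * b * x"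
proof -
  obtain l n u where *: "line3 l n x x u" "y = l * x + n"
      "Affine x y \<oplus>\<^sub>E Affine x y = Affine u (- (l * u + n))"
    using obtain_line3[of x y x y] assms by auto
  have "u * (4 * y ^ 2) = (x ^ 2 - a) ^ 2 - 8 * b * x"
    using line3D[OF *(1)] *(2) by Groebner_Basis.algebra
  with * that show ?thesis by blast
qed

text \<open>The squared slopes involve \<open>(y1 - y2) ^ 2\<close> and
  \<open>(y1 + y2) ^ 2\<close>; in their sum the mixed term cancels, leaving an expression in the
  abscissae.\<close>

lemma abscissa_add_sub:
  assumes "Affine x1 y1 \<in> points curve" "Affine x2 y2 \<in> points curve" "x1 \<noteq> x2"
  obtains u v u' v' where "Affine x1 y1 \<oplus>\<^sub>E Affine x2 y2 = Affine u v"
    "Affine x1 y1 \<oplus>\<^sub>E \<ominus>\<^sub>E Affine x2 y2 = Affine u' v'"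
    "(u + u') * (x1 - x2) ^ 2 = 2 * ((x1 + x2) * (x1 * x2 + a) + 2 * b)"
proof -
  obtain l n u where l: "line3 l n x1 x2 u" "y1 = l * x1 + n" "y2 = l * x2 + n"
      "Affine x1 y1 \<oplus>\<^sub>E Affine x2 y2 = Affine u (- (l * u + n))"
    using obtain_line3[OF assms(1,2)] assms(3) by metis
  obtain m k u' where m: "line3 m k x1 x2 u'" "y1 = m * x1 + k" "- y2 = m * x2 + k"
      "Affine x1 y1 \<oplus>\<^sub>E \<ominus>\<^sub>E Affine x2 y2 = Affine u' (- (m * u' + k))"
    using obtain_line3[of x1 y1 x2 "- y2"] assms by auto
  have on: "y1 ^ 2 = x1 ^ 3 + a * x1 + b" "y2 ^ 2 = x2 ^ 3 + a * x2 + b"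
    using assms by auto
  have "u * (x1 - x2) ^ 2 = (y1 - y2) ^ 2 - (x1 + x2) * (x1 - x2) ^ 2"
    using line3D(1)[OF l(1)] l(2,3) by Groebner_Basis.algebra
  moreover have "u' * (x1 - x2) ^ 2 = (y1 + y2) ^ 2 - (x1 + x2) * (x1 - x2) ^ 2"
    using line3D(1)[OF m(1)] m(2,3) by Groebner_Basis.algebra
  ultimately have "(u + u') * (x1 - x2) ^ 2 = 2 * ((x1 + x2) * (x1 * x2 + a) + 2 * b)"
    using on by Groebner_Basis.algebra
  with l m that show ?thesis by blast
qed

lemma abscissa_rep_double:
  assumes "P \<in> points curve" "abscissa_rep P (A, B)"
  shows "abscissa_rep (P \<oplus>\<^sub>E P)
    ((A ^ 2 - a * B ^ 2) ^ 2 - 8 * b * A * B ^ 3, 4 * B * (A ^ 3 + a * A * B ^ 2 + b * B ^ 3))"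
proof (cases P)
  case Origin
  with assms show ?thesis by simp
next
  case (Affine x y)
  have on: "y ^ 2 = x ^ 3 + a * x + b"
    using assms Affine by auto
  have AB: "A = x * B" "B \<noteq> 0"
    using assms Affine by auto
  have num: "(A ^ 2 - a * B ^ 2) ^ 2 - 8 * b * A * B ^ 3 = B ^ 4 * ((x ^ 2 - a) ^ 2 - 8 * b * x)"
    unfolding AB(1) by Groebner_Basis.algebra
  have den: "4 * B * (A ^ 3 + a * A * B ^ 2 + b * B ^ 3) = B ^ 4 * (4 * y ^ 2)"
    unfolding AB(1) on by Groebner_Basis.algebra
  show ?thesis
  proof (cases "y = 0")
    case True
    then have "x ^ 3 + a * x + b = 0"
      using on by simp
    \<comment> \<open>At a two-torsion point the numerator is the square of the derivative of the
      cubic, hence nonzero.\<close>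
    moreover from this have "(x ^ 2 - a) ^ 2 - 8 * b * x = (3 * x ^ 2 + a) ^ 2"
      by Groebner_Basis.algebra
    ultimately show ?thesis
      unfolding num den using True AB no_singular_point[of x] by (simp add: Affine)
  next
    case False
    then obtain u v where *: "P \<oplus>\<^sub>E P = Affine u v" "u * (4 * y ^ 2) = (x ^ 2 - a) ^ 2 - 8 * b * x"
      using abscissa_double[of x y] assms(1) Affine by metis
    then show ?thesis
      unfolding num den using False AB *(1) by (simp add: mult.left_commute[of u] flip: *(2))
  qed
qed

text \<open>Subtracting the known abscissa \<open>x\<close> of the difference from the sum in
  \<open>abscissa_add_sub\<close> isolates the abscissa of
  \<open>R \<oplus>\<^sub>E Q\<close>.\<close>

lemma abscissa_rep_add:
  assumes "R \<in> points curve" "Q \<in> points curve" "abscissa_rep R (A, B)" "abscissa_rep Q (A', B')"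
    and diff: "Q \<oplus>\<^sub>E \<ominus>\<^sub>E R = Affine x y"
  shows "abscissa_rep (R \<oplus>\<^sub>E Q)
    (2 * ((A * B' + A' * B) * (A * A' + a * B * B') + 2 * b * B ^ 2 * B' ^ 2) - x * (A * B' - A' * B) ^ 2,
     (A * B' - A' * B) ^ 2)"
proof (cases R; cases Q)
  assume "R = Origin" "Q = Origin"
  with diff show ?thesis by simp
next
  fix x' y' assume "R = Origin" "Q = Affine x' y'"
  with assms show ?thesis
    by (auto simp: power2_eq_square algebra_simps)
next
  fix x' y' assume "R = Affine x' y'" "Q = Origin"
  with assms show ?thesis
    by (auto simp: power2_eq_square algebra_simps)
next
  fix x1 y1 x2 y2 assume RQ: "R = Affine x1 y1" "Q = Affine x2 y2"
  have AB: "A = x1 * B" "A' = x2 * B'" "B \<noteq> 0" "B' \<noteq> 0"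
    using assms RQ by auto
  have den: "(A * B' - A' * B) ^ 2 = (B * B') ^ 2 * (x2 - x1) ^ 2"
    unfolding AB(1,2) by Groebner_Basis.algebra
  have num: "2 * ((A * B' + A' * B) * (A * A' + a * B * B') + 2 * b * B ^ 2 * B' ^ 2)
      - x * ((B * B') ^ 2 * (x2 - x1) ^ 2)
    = (B * B') ^ 2 * (2 * ((x2 + x1) * (x2 * x1 + a) + 2 * b) - x * (x2 - x1) ^ 2)"
    unfolding AB(1,2) by Groebner_Basis.algebra
  show ?thesis
  proof (cases "x1 = x2")
    case True
    have "R \<noteq> Q"
      using diff by auto
    then have y: "y2 = - y1" "y1 \<noteq> 0"
      using same_abscissa[of x1 y1 y2] assms RQ True by auto
    then have sum: "R \<oplus>\<^sub>E Q = Origin"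
      using RQ True by simp
    \<comment> \<open>The denominator is zero here, so this nonzero numerator is what makes the pair
      represent \<open>Origin\<close>.\<close>
    have "2 * ((x2 + x1) * (x2 * x1 + a) + 2 * b) - x * (x2 - x1) ^ 2 = 4 * y1 ^ 2"
      using assms(1) RQ True by (simp add: algebra_simps power3_eq_cube power2_eq_square)
    then show ?thesis
      unfolding den num sum using True y AB by simp
  next
    case False
    then obtain u v where QR: "Affine x2 y2 \<oplus>\<^sub>E Affine x1 y1 = Affine u v"
        and *: "(u + x) * (x2 - x1) ^ 2 = 2 * ((x2 + x1) * (x2 * x1 + a) + 2 * b)"
      using abscissa_add_sub[of x2 y2 x1 y1] assms RQ by (metis point.inject)
    have eq: "2 * ((x2 + x1) * (x2 * x1 + a) + 2 * b) - x * (x2 - x1) ^ 2 = u * (x2 - x1) ^ 2"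
      by (simp only: flip: *) (simp add: algebra_simps)
    have "R \<oplus>\<^sub>E Q = Affine u v"
      using add_commute[OF assms(1,2)] RQ QR by metis
    then show ?thesis
      unfolding den num eq using False AB by simp
  qed
qed

theorem abscissa_rep_mult:
  assumes "Affine x y \<in> points curve"
  shows "abscissa_rep (mult n (Affine x y)) (xmult a b x n)"
proof (induction n rule: double_induct)
  case (even k)
  then have "abscissa_rep (mult k (Affine x y)) (xnum a b x k, xden a b x k)"
    by simp
  from abscissa_rep_double[OF _ this]
  have "abscissa_rep (mult (2 * k) (Affine x y)) (xnum a b x (2 * k), xden a b x (2 * k))"
    using assms unfolding mult_2 mult_add[OF assms] by (simp flip: mult_2 add: xmult_double)
  then show ?case by simp
next
  case (odd k)
  let ?P = "Affine x y"
  have "abscissa_rep (mult k ?P) (xnum a b x k, xden a b x k)"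
      "abscissa_rep (mult (Suc k) ?P) (xnum a b x (Suc k), xden a b x (Suc k))"
    using odd by simp_all
  moreover have "mult (Suc k) ?P \<oplus>\<^sub>E \<ominus>\<^sub>E mult k ?P = ?P"
    unfolding mult_Suc using assms by (intro add_neg_cancel) auto
  ultimately have "abscissa_rep (mult k ?P \<oplus>\<^sub>E mult (Suc k) ?P)
      (xnum a b x (Suc (2 * k)), xden a b x (Suc (2 * k)))"
    unfolding xnum_odd xden_odd divpol_def using assms by (intro abscissa_rep_add) auto
  moreover have "mult k ?P \<oplus>\<^sub>E mult (Suc k) ?P = mult (Suc (2 * k)) ?P"
    using mult_add[OF assms, of k "Suc k"] by (simp add: mult_2)
  ultimately show ?case by simp
qed auto

corollary Affine_in_torsion_iff:
  "Affine x y \<in> torsion curve n \<longleftrightarrow> y ^ 2 = x ^ 3 + a * x + b \<and> xden a b x n = 0"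
proof -
  have "mult n (Affine x y) = Origin \<longleftrightarrow> xden a b x n = 0" if "Affine x y \<in> points curve"
    using abscissa_rep_mult[OF that, of n]
    by (cases "mult n (Affine x y)"; cases "xmult a b x n") auto
  then show ?thesis
    by (auto simp: torsion_def)
qed

end

section \<open>Leading coefficients\<close>

text \<open>Since \<open>c\<close> may be zero and \<open>d\<close> is only a bound, the notion
  survives cancellation in sums and vanishing products, unlike \<open>degree\<close> with
  \<open>lead_coeff\<close>.\<close>

definition top_coeff :: "'a::comm_ring_1 poly \<Rightarrow> nat \<Rightarrow> 'a \<Rightarrow> bool" where
  "top_coeff p d c \<longleftrightarrow> degree p \<le> d \<and> coeff p d = c"

lemma top_coeff_add: "top_coeff p d c \<Longrightarrow> top_coeff q d c' \<Longrightarrow> top_coeff (p + q) d (c + c')"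
  by (auto simp: top_coeff_def degree_add_le)

lemma top_coeff_diff: "top_coeff p d c \<Longrightarrow> top_coeff q d c' \<Longrightarrow> top_coeff (p - q) d (c - c')"
  by (auto simp: top_coeff_def degree_diff_le)

lemma top_coeff_mult:
  assumes "top_coeff p d c" "top_coeff q e c'"
  shows "top_coeff (p * q) (d + e) (c * c')"
proof -
  have "coeff p i * coeff q (d + e - i) = 0" if "i \<noteq> d" for i
    using assms that coeff_eq_0[of p i] coeff_eq_0[of q "d + e - i"]
    unfolding top_coeff_def by (cases "i < d") auto
  then have "coeff (p * q) (d + e) = (\<Sum>i\<in>{d}. coeff p i * coeff q (d + e - i))"
    unfolding coeff_mult by (intro sum.mono_neutral_right) auto
  then show ?thesis
    using assms degree_mult_le[of p q] by (auto simp: top_coeff_def)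
qed

lemma top_coeff_const: "top_coeff [:c:] 0 c"
  by (simp add: top_coeff_def)

lemma top_coeff_cmult: "top_coeff p d c \<Longrightarrow> top_coeff ([:k:] * p) d (k * c)"
  using top_coeff_mult[OF top_coeff_const[of k]] by simp

lemma top_coeff_numeral_mult: "top_coeff p d c \<Longrightarrow> top_coeff (numeral k * p) d (numeral k * c)"
  using top_coeff_cmult[of p d c "numeral k"] by (simp add: numeral_poly)

lemma top_coeff_power: "top_coeff p d c \<Longrightarrow> top_coeff (p ^ n) (n * d) (c ^ n)"
proof (induction n)
  case 0
  show ?case by (simp add: top_coeff_def)
next
  case (Suc n)
  then show ?case using top_coeff_mult[of p d c "p ^ n" "n * d" "c ^ n"] by simp
qed

lemma top_coeff_pCons: "top_coeff (pCons 0 p) (Suc d) c \<Longrightarrow> top_coeff p d c"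
  by (cases "p = 0") (auto simp: top_coeff_def)

lemma top_coeff_pCons_drop: "top_coeff (pCons 0 p) d c \<Longrightarrow> top_coeff p d 0"
  using coeff_eq_0[of "pCons 0 p" "Suc d"] by (cases "p = 0") (auto simp: top_coeff_def)

lemma pCons_0_mult: "pCons 0 p * q = pCons 0 (p * q)" "q * pCons 0 p = pCons 0 (q * p)"
  by (simp_all add: mult.commute)

section \<open>Degrees of the generic numerators and denominators\<close>

context
  fixes a b :: "'a::comm_ring_1"
begin

abbreviation xnum_poly :: "nat \<Rightarrow> 'a poly" where
  "xnum_poly \<equiv> xnum [:a:] [:b:] [:0, 1:]"

abbreviation xden_poly :: "nat \<Rightarrow> 'a poly" where
  "xden_poly \<equiv> xden [:a:] [:b:] [:0, 1:]"

abbreviation divpol_poly :: "nat \<Rightarrow> 'a poly" where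
  "divpol_poly \<equiv> divpol [:a:] [:b:] [:0, 1:]"

lemma poly_xmult:
  "poly (xnum_poly n) x = xnum a b x n \<and> poly (xden_poly n) x = xden a b x n"
  by (induction n rule: double_induct) (simp_all add: xmult_double xnum_odd xden_odd divpol_def mult.assoc)

lemma poly_divpol: "poly (divpol_poly k) x = divpol a b x k"
  by (simp add: divpol_def poly_xmult)

text \<open>The two cross products have equal degree bounds and top coefficients
  \<open>(k + 1) ^ 2\<close> and \<open>k ^ 2\<close>. Their difference \<open>2 * k + 1\<close> is
  the integer whose square root, up to sign, is found later.\<close>

lemma top_coeff_divpol_aux:
  assumes "top_coeff (xnum_poly k) (k ^ 2) 1" "top_coeff (pCons 0 (xden_poly k)) (k ^ 2) (of_nat k ^ 2)"
    and "top_coeff (xnum_poly (Suc k)) (Suc k ^ 2) 1"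
      "top_coeff (pCons 0 (xden_poly (Suc k))) (Suc k ^ 2) (of_nat (Suc k) ^ 2)"
  shows "top_coeff (divpol_poly k) (2 * k * Suc k) (of_nat (Suc (2 * k)))"
    and "top_coeff (xnum_poly k * xden_poly (Suc k) + xnum_poly (Suc k) * xden_poly k)
      (2 * k * Suc k) (of_nat (Suc k) ^ 2 + of_nat k ^ 2)"
proof -
  have d: "k ^ 2 + Suc k ^ 2 = Suc (2 * k * Suc k)" "Suc k ^ 2 + k ^ 2 = Suc (2 * k * Suc k)"
    by (simp_all add: power2_eq_square)
  have 1: "top_coeff (pCons 0 (xnum_poly k * xden_poly (Suc k))) (Suc (2 * k * Suc k)) (of_nat (Suc k) ^ 2)"
    using top_coeff_mult[OF assms(1,4)] unfolding d pCons_0_mult by simp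
  have 2: "top_coeff (pCons 0 (xnum_poly (Suc k) * xden_poly k)) (Suc (2 * k * Suc k)) (of_nat k ^ 2)"
    using top_coeff_mult[OF assms(3,2)] unfolding d pCons_0_mult by simp
  have "(of_nat (Suc k) ^ 2 - of_nat k ^ 2 :: 'a) = of_nat (Suc (2 * k))"
    by (simp add: power2_eq_square algebra_simps)
  then show "top_coeff (divpol_poly k) (2 * k * Suc k) (of_nat (Suc (2 * k)))"
    using top_coeff_diff[OF top_coeff_pCons[OF 1] top_coeff_pCons[OF 2]] by (simp add: divpol_def)
  show "top_coeff (xnum_poly k * xden_poly (Suc k) + xnum_poly (Suc k) * xden_poly k)
      (2 * k * Suc k) (of_nat (Suc k) ^ 2 + of_nat k ^ 2)"
    by (rule top_coeff_add[OF top_coeff_pCons[OF 1] top_coeff_pCons[OF 2]])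
qed

text \<open>The expected degree of the denominator is \<open>n ^ 2 - 1\<close>; the extra factor of
  the variable avoids this subtraction, which would truncate at \<open>n = 0\<close>.\<close>

lemma top_coeff_xmult:
  "top_coeff (xnum_poly n) (n ^ 2) 1 \<and> top_coeff (pCons 0 (xden_poly n)) (n ^ 2) (of_nat n ^ 2)"
proof (induction n rule: double_induct)
  case (even k)
  define A B where "A = xnum_poly k" and "B = xden_poly k"
  have A: "top_coeff A (k ^ 2) 1" and XB: "top_coeff (pCons 0 B) (k ^ 2) (of_nat k ^ 2)"
    using even by (auto simp: A_def B_def)
  \<comment> \<open>Relative to the bound \<open>k ^ 2\<close>, the denominator has top coefficient
    zero, so only the powers of \<open>A\<close> contribute to the numerator.\<close>
  have B: "top_coeff B (k ^ 2) 0"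
    by (rule top_coeff_pCons_drop[OF XB])
  have "top_coeff (A ^ 2 - [:a:] * B ^ 2) (2 * k ^ 2) 1"
    using top_coeff_diff[OF top_coeff_power[OF A, of 2] top_coeff_cmult[OF top_coeff_power[OF B, of 2], of a]]
    by simp
  from top_coeff_power[OF this, of 2]
  have 1: "top_coeff ((A ^ 2 - [:a:] * B ^ 2) ^ 2) ((2 * k) ^ 2) 1"
    by (simp add: power2_eq_square)
  have "top_coeff (8 * [:b:] * A * B ^ 3) ((2 * k) ^ 2) 0"
    using top_coeff_mult[OF top_coeff_numeral_mult[OF top_coeff_cmult[OF A, of b], of "num.Bit0 (num.Bit0 (num.Bit0 num.One))"]
        top_coeff_power[OF B, of 3]] by (simp add: power2_eq_square)
  from top_coeff_diff[OF 1 this]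
  have 2: "top_coeff (xnum_poly (2 * k)) ((2 * k) ^ 2) 1"
    by (simp add: xmult_double A_def B_def)
  have h: "top_coeff (A ^ 3) (3 * k ^ 2) 1" "top_coeff ([:b:] * B ^ 3) (3 * k ^ 2) 0"
    using top_coeff_power[OF A, of 3] top_coeff_cmult[OF top_coeff_power[OF B, of 3]] by auto
  have "top_coeff ([:a:] * A * B ^ 2) (3 * k ^ 2) 0"
    using top_coeff_mult[OF top_coeff_cmult[OF A] top_coeff_power[OF B, of 2]] by simp
  from top_coeff_add[OF top_coeff_add[OF h(1) this] h(2)]
  have "top_coeff (A ^ 3 + [:a:] * A * B ^ 2 + [:b:] * B ^ 3) (3 * k ^ 2) 1"
    by simp
  from top_coeff_mult[OF top_coeff_numeral_mult[OF XB, of "num.Bit0 (num.Bit0 num.One)"] this]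
  have "top_coeff (pCons 0 (xden_poly (2 * k))) ((2 * k) ^ 2) (of_nat (2 * k) ^ 2)"
    by (simp add: xmult_double A_def B_def power2_eq_square pCons_0_mult)
  with 2 show ?case by blast
next
  case (odd k)
  define A B where "A = xnum_poly k" and "B = xden_poly k"
  define A' B' where "A' = xnum_poly (Suc k)" and "B' = xden_poly (Suc k)"
  define P where "P = divpol_poly k"
  have A: "top_coeff A (k ^ 2) 1" and XB: "top_coeff (pCons 0 B) (k ^ 2) (of_nat k ^ 2)"
    and A': "top_coeff A' (Suc k ^ 2) 1" and XB': "top_coeff (pCons 0 B') (Suc k ^ 2) (of_nat (Suc k) ^ 2)"
    using odd by (auto simp: A_def B_def A'_def B'_def)
  have B: "top_coeff B (k ^ 2) 0" "top_coeff B' (Suc k ^ 2) 0"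
    using top_coeff_pCons_drop XB XB' by blast+
  have P: "top_coeff P (2 * k * Suc k) (of_nat (Suc (2 * k)))"
    and S: "top_coeff (A * B' + A' * B) (2 * k * Suc k) (of_nat (Suc k) ^ 2 + of_nat k ^ 2)"
    using top_coeff_divpol_aux[of k] odd by (auto simp: A_def B_def A'_def B'_def P_def)
  have d: "k ^ 2 + Suc k ^ 2 = Suc (2 * k * Suc k)"
    and d': "2 * k * Suc k + Suc (2 * k * Suc k) = Suc (2 * k) ^ 2"
      "Suc (2 * (2 * k * Suc k)) = Suc (2 * k) ^ 2"
    by (simp_all add: power2_eq_square algebra_simps)
  have BB: "top_coeff (B * B') (Suc (2 * k * Suc k)) 0"
    using top_coeff_mult[OF B] by (simp only: d mult_zero_left)
  have "top_coeff (pCons 0 (B * B')) (Suc (2 * k * Suc k)) 0"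
    using top_coeff_mult[OF XB B(2)] by (simp only: d mult_zero_right pCons_0_mult)
  then have BB': "top_coeff (B * B') (2 * k * Suc k) 0"
    by (rule top_coeff_pCons)
  have "top_coeff (A * A') (Suc (2 * k * Suc k)) 1"
    using top_coeff_mult[OF A A'] by (simp only: d mult_1)
  from top_coeff_mult[OF S top_coeff_add[OF this top_coeff_cmult[OF BB, of a]]]
  have 1: "top_coeff ((A * B' + A' * B) * (A * A' + [:a:] * B * B')) (Suc (2 * k) ^ 2)
      (of_nat (Suc k) ^ 2 + of_nat k ^ 2)"
    unfolding d' by (simp add: mult.assoc)
  from top_coeff_cmult[OF top_coeff_mult[OF BB' BB], of "2 * b"]
  have 2: "top_coeff (2 * [:b:] * B ^ 2 * B' ^ 2) (Suc (2 * k) ^ 2) 0"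
    unfolding d' by (simp add: power2_eq_square numeral_poly mult_ac)
  have "top_coeff [:0, 1:] (Suc 0) (1 :: 'a)"
    by (simp add: top_coeff_def)
  from top_coeff_mult[OF this top_coeff_power[OF P, of 2]]
  have 3: "top_coeff (pCons 0 (P ^ 2)) (Suc (2 * k) ^ 2) (of_nat (Suc (2 * k)) ^ 2)"
    unfolding add_Suc add_0 d' by simp
  \<comment> \<open>This identity keeps the numerator monic.\<close>
  have "2 * (of_nat (Suc k) ^ 2 + of_nat k ^ 2) - of_nat (Suc (2 * k)) ^ 2 = (1 :: 'a)"
    by (simp add: power2_eq_square algebra_simps)
  then have "top_coeff (xnum_poly (Suc (2 * k))) (Suc (2 * k) ^ 2) 1"
    using top_coeff_diff[OF top_coeff_numeral_mult[OF top_coeff_add[OF 1 2], of "num.Bit0 num.One"] 3]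
    by (simp add: xnum_odd A_def B_def A'_def B'_def P_def)
  with 3 show ?case
    by (simp add: xden_odd P_def)
qed (auto simp: top_coeff_def)

lemmas top_coeff_divpol =
  top_coeff_divpol_aux(1)[OF conjunct1[OF top_coeff_xmult] conjunct2[OF top_coeff_xmult]
    conjunct1[OF top_coeff_xmult] conjunct2[OF top_coeff_xmult]]

end

section \<open>Square roots in fields of torsion points\<close>

locale subfield_set =
  fixes K :: "'a::field set"
  assumes one_closed [simp, intro]: "1 \<in> K"
    and add_closed [simp, intro]: "x \<in> K \<Longrightarrow> y \<in> K \<Longrightarrow> x + y \<in> K"
    and uminus_closed [simp, intro]: "x \<in> K \<Longrightarrow> - x \<in> K"
    and mult_closed [simp, intro]: "x \<in> K \<Longrightarrow> y \<in> K \<Longrightarrow> x * y \<in> K"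
    and inverse_closed [simp, intro]: "x \<in> K \<Longrightarrow> inverse x \<in> K"
begin

lemma zero_closed [simp, intro]: "0 \<in> K"
  using add_closed[of 1 "- 1"] by simp

lemma diff_closed [simp, intro]: "x \<in> K \<Longrightarrow> y \<in> K \<Longrightarrow> x - y \<in> K"
  using add_closed[of x "- y"] by simp

lemma divide_closed [simp, intro]: "x \<in> K \<Longrightarrow> y \<in> K \<Longrightarrow> x / y \<in> K"
  by (simp add: divide_inverse)

lemma power_closed [simp, intro]: "x \<in> K \<Longrightarrow> x ^ n \<in> K"
  by (induction n) auto

lemma of_nat_closed [simp, intro]: "of_nat n \<in> K"
  by (induction n) auto

lemma numeral_closed [simp, intro]: "numeral n \<in> K"
  using of_nat_closed[of "numeral n"] by simp

lemma prod_mset_closed [intro]: "(\<And>x. x \<in># M \<Longrightarrow> f x \<in> K) \<Longrightarrow> (\<Prod>x\<in>#M. f x) \<in> K"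
  by (induction M) auto

definition square_in :: "'a \<Rightarrow> bool" where
  "square_in x \<longleftrightarrow> (\<exists>t\<in>K. t ^ 2 = x)"

lemma square_in_mult: "square_in x \<Longrightarrow> square_in y \<Longrightarrow> square_in (x * y)"
  unfolding square_in_def by (metis mult_closed power_mult_distrib)

lemma square_in_divide: "square_in x \<Longrightarrow> square_in y \<Longrightarrow> square_in (x / y)"
  unfolding square_in_def by (metis divide_closed power_divide)

lemma square_in_power2: "x \<in> K \<Longrightarrow> square_in (x ^ 2)"
  unfolding square_in_def by blast

lemma square_in_power: "square_in x \<Longrightarrow> square_in (x ^ n)"
  by (induction n) (auto intro: square_in_mult square_in_power2[of 1, simplified])

lemma square_in_cancel_left:
  assumes "square_in (x * y)" "square_in x" "x \<noteq> 0"
  shows "square_in y"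
  using square_in_divide[OF assms(1,2)] assms(3) by simp

end

lemma prod_mset_uminus: "(\<Prod>x\<in>#M. - f x) = (- 1) ^ size M * (\<Prod>x\<in>#M. f x :: 'a::comm_ring_1)"
  by (induction M) auto

locale torsion_field = short_weierstrass a b + subfield_set K
  for a b :: "'a::{alg_closed_field, field_char_0}" and K :: "'a set" +
  assumes coeffs_closed [simp]: "a \<in> K" "b \<in> K"
begin

text \<open>Over the rationals this expresses that the \<open>n\<close>-division field lies in
  \<open>K\<close>; see \<open>division_field_subset_iff\<close>.\<close>

definition contains_torsion :: "nat \<Rightarrow> bool" where
  "contains_torsion n \<longleftrightarrow> (\<forall>x y. Affine x y \<in> torsion curve n \<longrightarrow> x \<in> K \<and> y \<in> K)"

lemma contains_torsionD:
  "contains_torsion n \<Longrightarrow> Affine x y \<in> torsion curve m \<Longrightarrow> m dvd n \<Longrightarrow> x \<in> K \<and> y \<in> K"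
  using torsion_dvd_mono unfolding contains_torsion_def by blast

lemma Affine_in_torsion_2_iff: "Affine e 0 \<in> torsion curve 2 \<longleftrightarrow> e ^ 3 + a * e + b = 0"
proof -
  have "xden a b e 2 = 4 * (e ^ 3 + a * e + b)"
    using xmult_double(2)[of a b e 1] by simp
  then show ?thesis
    by (auto simp: Affine_in_torsion_iff simp del: distrib_left_numeral)
qed

lemma two_torsion_closed:
  assumes "contains_torsion n" "even n" "e ^ 3 + a * e + b = 0"
  shows "e \<in> K"
  using contains_torsionD[OF assms(1), of e 0 2] assms by (simp add: Affine_in_torsion_2_iff)

lemma cubic_splits:
  obtains e1 e2 e3 where "\<And>x. x ^ 3 + a * x + b = (x - e1) * (x - e2) * (x - e3)"
    "- (4 * a ^ 3 + 27 * b ^ 2) = ((e1 - e2) * (e1 - e3) * (e2 - e3)) ^ 2"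
    "e1 \<noteq> e2" "e1 \<noteq> e3" "e2 \<noteq> e3"
proof -
  obtain e1 where e1: "e1 ^ 3 + a * e1 + b = 0"
    using alg_closed_imp_poly_has_root[of "[:b, a, 0, 1:]"] by (auto simp: algebra_simps power3_eq_cube)
  \<comment> \<open>The polynomial is the quotient of the cubic by its linear factor at
    \<open>e1\<close>.\<close>
  obtain e2 where e2: "e2 ^ 2 + e1 * e2 + (a + e1 ^ 2) = 0"
    using alg_closed_imp_poly_has_root[of "[:a + e1 ^ 2, e1, 1:]"]
    by (auto simp: algebra_simps power2_eq_square)
  define e3 where "e3 = - e1 - e2"
  have cubic: "x ^ 3 + a * x + b = (x - e1) * (x - e2) * (x - e3)" for x
    using e1 e2 unfolding e3_def by Groebner_Basis.algebra
  have disc: "- (4 * a ^ 3 + 27 * b ^ 2) = ((e1 - e2) * (e1 - e3) * (e2 - e3)) ^ 2"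
  proof -
    have "a = - (e2 ^ 2 + e1 * e2 + e1 ^ 2)"
      using e2 by Groebner_Basis.algebra
    moreover have "b = e1 * e2 * (e1 + e2)"
      using e1 e2 by Groebner_Basis.algebra
    ultimately show ?thesis
      unfolding e3_def by Groebner_Basis.algebra
  qed
  moreover have "- (4 * a ^ 3 + 27 * b ^ 2) \<noteq> 0"
    using nonsingular by (simp only: neg_equal_0_iff_equal not_False_eq_True)
  ultimately have "(e1 - e2) * (e1 - e3) * (e2 - e3) \<noteq> 0"
    by force
  then show ?thesis
    using that[OF cubic disc] by auto
qed

text \<open>The multiples alternate between \<open>Origin\<close> and the point itself. The content
  is that the scaling factor of the pair is a nonzero square in \<open>K\<close>.\<close>

lemma xmult_two_torsion:
  assumes "e ^ 3 + a * e + b = 0" "e \<in> K"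
  shows "\<exists>s\<in>K. s \<noteq> 0 \<and> xmult a b e n = (if even n then (s ^ 2, 0) else (e * s ^ 2, s ^ 2))"
proof (induction n rule: double_induct)
  case (even k)
  then obtain s where s: "s \<in> K" "s \<noteq> 0"
      "xmult a b e k = (if even k then (s ^ 2, 0) else (e * s ^ 2, s ^ 2))"
    by blast
  show ?case
  proof (cases "even k")
    case True
    then have "xmult a b e (2 * k) = ((s ^ 4) ^ 2, 0)"
      using s by (simp add: prod_eq_iff xmult_double flip: power_mult)
    moreover have "s ^ 4 \<in> K" "s ^ 4 \<noteq> 0"
      using s by auto
    ultimately show ?thesis
      by (metis even_mult_iff even_numeral)
  next
    case False
    \<comment> \<open>The numerator of the duplication formula at a root of the cubic is the square
      of the derivative there.\<close>
    let ?t = "s ^ 4 * (3 * e ^ 2 + a)"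
    have k: "xnum a b e k = e * s ^ 2" "xden a b e k = s ^ 2"
      using s False by simp_all
    have "xnum a b e (2 * k) = ?t ^ 2"
      unfolding xmult_double k using assms(1) by Groebner_Basis.algebra
    moreover have "xden a b e (2 * k) = s ^ 8 * 4 * (e ^ 3 + a * e + b)"
      unfolding xmult_double k by Groebner_Basis.algebra
    ultimately have "xmult a b e (2 * k) = (?t ^ 2, 0)"
      using assms(1) by (simp add: prod_eq_iff)
    moreover have "?t \<in> K" "?t \<noteq> 0"
      using s assms no_singular_point[of e] by auto
    ultimately show ?thesis
      by (metis even_mult_iff even_numeral)
  qed
next
  case (odd k)
  then obtain s t where s: "s \<in> K" "s \<noteq> 0"
      "xmult a b e k = (if even k then (s ^ 2, 0) else (e * s ^ 2, s ^ 2))"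
    and t: "t \<in> K" "t \<noteq> 0"
      "xmult a b e (Suc k) = (if odd k then (t ^ 2, 0) else (e * t ^ 2, t ^ 2))"
    by auto
  have "xmult a b e (Suc (2 * k)) = (e * (s ^ 2 * t ^ 2) ^ 2, (s ^ 2 * t ^ 2) ^ 2)"
  proof (cases "even k")
    case True
    then have *: "xnum a b e k = s ^ 2" "xden a b e k = 0"
        "xnum a b e (Suc k) = e * t ^ 2" "xden a b e (Suc k) = t ^ 2"
      using s t by simp_all
    show ?thesis
      unfolding prod_eq_iff fst_conv snd_conv xnum_odd xden_odd divpol_def *
      by (simp add: power2_eq_square algebra_simps)
  next
    case False
    then have *: "xnum a b e k = e * s ^ 2" "xden a b e k = s ^ 2"
        "xnum a b e (Suc k) = t ^ 2" "xden a b e (Suc k) = 0"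
      using s t by simp_all
    show ?thesis
      unfolding prod_eq_iff fst_conv snd_conv xnum_odd xden_odd divpol_def *
      by (simp add: power2_eq_square algebra_simps)
  qed
  moreover have "s ^ 2 * t ^ 2 \<in> K" "s ^ 2 * t ^ 2 \<noteq> 0"
    using s t by auto
  ultimately show ?case
    by (metis even_Suc even_mult_iff even_numeral)
qed (auto intro!: bexI[of _ 1])

text \<open>One of two consecutive multiples is \<open>Origin\<close>, so a single cross product
  survives; the parity of \<open>k\<close> decides which, hence the sign.\<close>

lemma divpol_two_torsion:
  assumes "e ^ 3 + a * e + b = 0" "e \<in> K"
  shows "\<exists>s\<in>K. s \<noteq> 0 \<and> divpol a b e k = (- 1) ^ k * s ^ 2"
proof -
  obtain s t where s: "s \<in> K" "s \<noteq> 0"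
      "xmult a b e k = (if even k then (s ^ 2, 0) else (e * s ^ 2, s ^ 2))"
    and t: "t \<in> K" "t \<noteq> 0"
      "xmult a b e (Suc k) = (if odd k then (t ^ 2, 0) else (e * t ^ 2, t ^ 2))"
    using xmult_two_torsion[OF assms, of k] xmult_two_torsion[OF assms, of "Suc k"] by auto
  have "divpol a b e k = (- 1) ^ k * (s * t) ^ 2"
    using s t by (cases "even k") (simp_all add: divpol_def power_mult_distrib)
  moreover have "s * t \<in> K" "s * t \<noteq> 0"
    using s t by auto
  ultimately show ?thesis by blast
qed

text \<open>The resultant of the cubic and the division polynomial is computed twice: over the roots
  of the cubic it is a square up to sign, over those of the division polynomial it is
  \<open>F ^ 2\<close> times \<open>n ^ 3\<close>.\<close>

theorem sqrt_odd_closed: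
  assumes "contains_torsion (2 * Suc (2 * k))"
  shows "\<exists>t\<in>K. t ^ 2 = (- 1) ^ k * of_nat (Suc (2 * k))"
proof -
  define n where "n = Suc (2 * k)"
  define p where "p = divpol [:a:] [:b:] [:0, 1:] k"
  have top: "top_coeff p (2 * k * Suc k) (of_nat n)"
    unfolding p_def n_def by (rule top_coeff_divpol)
  have n: "(of_nat n :: 'a) \<noteq> 0"
    unfolding n_def by (simp only: of_nat_eq_0_iff)
  have deg: "degree p = 2 * k * Suc k" "lead_coeff p = of_nat n" "p \<noteq> 0"
    using top n le_degree[of p "2 * k * Suc k"] by (auto simp: top_coeff_def intro: le_antisym)
  then obtain M where M: "size M = 2 * k * Suc k" "p = smult (of_nat n) (\<Prod>x\<in>#M. [:- x, 1:])"
    using alg_closed_imp_factorization[of p] by metis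
  have val: "divpol a b x k = of_nat n * (\<Prod>r\<in>#M. r - x)" for x
  proof -
    have "divpol a b x k = poly p x"
      by (simp add: p_def poly_divpol)
    also have "\<dots> = of_nat n * (\<Prod>r\<in>#M. - (r - x))"
      by (simp add: M(2) poly_prod_mset)
    \<comment> \<open>The number \<open>size M = 2 * k * Suc k\<close> is even, so the signs
      cancel.\<close>
    also have "\<dots> = of_nat n * (\<Prod>r\<in>#M. r - x)"
      by (simp only: prod_mset_uminus M(1)) simp
    finally show ?thesis .
  qed
  \<comment> \<open>By \<open>xden_odd\<close> a root of the division polynomial is the abscissa of
    a point killed by \<open>n\<close>, so the ordinates above it lie in \<open>K\<close>.\<close>
  have "\<exists>y. y \<in> K \<and> y ^ 2 = r ^ 3 + a * r + b" if "r \<in># M" for r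
  proof -
    have "divpol a b r k = 0"
      using that by (auto simp: val image_iff prod_mset_zero_iff)
    moreover obtain y where "Affine r y \<in> points curve"
      using exists_point_above by blast
    ultimately have "Affine r y \<in> torsion curve n" "y ^ 2 = r ^ 3 + a * r + b"
      by (auto simp: Affine_in_torsion_iff n_def xden_odd)
    then show ?thesis
      using contains_torsionD[OF assms, of r y n] by (auto simp: n_def simp del: mult_Suc_right)
  qed
  then obtain Y where Y: "\<And>r. r \<in># M \<Longrightarrow> Y r \<in> K \<and> Y r ^ 2 = r ^ 3 + a * r + b"
    by metis
  define F where "F = (\<Prod>r\<in>#M. Y r)"
  have F: "F \<in> K"
    unfolding F_def using Y by blast
  obtain e1 e2 e3 where e: "\<And>x. x ^ 3 + a * x + b = (x - e1) * (x - e2) * (x - e3)"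
    using cubic_splits by metis
  have roots: "x ^ 3 + a * x + b = 0" if "x \<in> {e1, e2, e3}" for x
    using that e[of x] by auto
  have sq: "\<exists>s\<in>K. s \<noteq> 0 \<and> divpol a b x k = (- 1) ^ k * s ^ 2" if "x \<in> {e1, e2, e3}" for x
    by (intro divpol_two_torsion roots two_torsion_closed[OF assms] that) simp
  obtain s1 where s1: "s1 \<in> K" "s1 \<noteq> 0" "divpol a b e1 k = (- 1) ^ k * s1 ^ 2"
    using sq[of e1] by auto
  obtain s2 where s2: "s2 \<in> K" "s2 \<noteq> 0" "divpol a b e2 k = (- 1) ^ k * s2 ^ 2"
    using sq[of e2] by auto
  obtain s3 where s3: "s3 \<in> K" "s3 \<noteq> 0" "divpol a b e3 k = (- 1) ^ k * s3 ^ 2"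
    using sq[of e3] by auto
  note s = s1 s2 s3
  \<comment> \<open>One more factor \<open>n\<close> turns \<open>n ^ 3 * F ^ 2\<close> into the
    square of \<open>n ^ 2 * F\<close>.\<close>
  define t where "t = of_nat n ^ 2 * F / (s1 * s2 * s3)"
  have "F ^ 2 = (\<Prod>r\<in>#M. Y r ^ 2)"
    by (simp add: F_def power2_eq_square prod_mset.distrib)
  also have "\<dots> = (\<Prod>r\<in>#M. (r - e1) * (r - e2) * (r - e3))"
    using Y e by (intro arg_cong[where f = prod_mset] image_mset_cong) metis
  also have "\<dots> = (\<Prod>r\<in>#M. r - e1) * (\<Prod>r\<in>#M. r - e2) * (\<Prod>r\<in>#M. r - e3)"
    by (simp add: prod_mset.distrib)
  finally have "of_nat n ^ 3 * F ^ 2 = divpol a b e1 k * divpol a b e2 k * divpol a b e3 k"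
    by (simp add: val power3_eq_cube)
  also have "\<dots> = (- 1) ^ k * (s1 * s2 * s3) ^ 2 * ((- 1) ^ k * (- 1) ^ k)"
    unfolding s(3,6,9) by (simp add: power2_eq_square mult_ac)
  also have "(- 1) ^ k * (- 1) ^ k = (1 :: 'a)"
    by (simp flip: power_add mult_2)
  finally have "of_nat n ^ 3 * F ^ 2 = (- 1) ^ k * (s1 * s2 * s3) ^ 2"
    by simp
  then have "of_nat n * (of_nat n ^ 3 * F ^ 2) = ((- 1) ^ k * of_nat n) * (s1 * s2 * s3) ^ 2"
    by simp
  moreover have "of_nat n * (of_nat n ^ 3 * F ^ 2) = (of_nat n ^ 2 * F) ^ 2"
    by (simp add: power_mult_distrib power2_eq_square power3_eq_cube)
  ultimately have "t ^ 2 = (- 1) ^ k * of_nat n"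
    using s by (simp add: t_def power_divide divide_eq_eq)
  moreover have "t \<in> K"
    using s F by (simp add: t_def)
  ultimately show ?thesis
    unfolding n_def by blast
qed

section \<open>Halving points; square roots of -1 and 2\<close>

lemma half_point:
  assumes "Affine x y \<in> torsion curve n"
  obtains u v where "Affine u v \<in> torsion curve (2 * n)" "v \<noteq> 0"
    "\<And>e. e ^ 3 + a * e + b = 0 \<Longrightarrow> (x - e) * (2 * v) ^ 2 = ((u - e) ^ 2 - (3 * e ^ 2 + a)) ^ 2"
proof -
  \<comment> \<open>The quartic is the duplication formula for the abscissa \<open>x\<close> with
    denominators cleared.\<close>
  have "\<exists>u. poly [:a ^ 2 - 4 * x * b, - 8 * b - 4 * x * a, - 2 * a, - 4 * x, 1:] u = 0"
    by (rule alg_closed_imp_poly_has_root) simp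
  then obtain u where "poly [:a ^ 2 - 4 * x * b, - 8 * b - 4 * x * a, - 2 * a, - 4 * x, 1:] u = 0" ..
  then have u: "(u ^ 2 - a) ^ 2 - 8 * b * u = x * (4 * (u ^ 3 + a * u + b))"
    by simp Groebner_Basis.algebra
  obtain v where v: "v ^ 2 = u ^ 3 + a * u + b"
    using nth_root_exists[of 2] by auto
  have v0: "v \<noteq> 0"
  proof
    assume "v = 0"
    with v have "u ^ 3 + a * u + b = 0" by simp
    moreover from this u have "(3 * u ^ 2 + a) ^ 2 = 0"
      by Groebner_Basis.algebra
    ultimately show False
      using no_singular_point[of u] by simp
  qed
  have "xmult a b u 2 = (x * (4 * v ^ 2), 4 * v ^ 2)"
    using xmult_double[of a b u 1] u v by (simp add: prod_eq_iff)
  then have "abscissa_rep (mult 2 (Affine u v)) (x * (4 * v ^ 2), 4 * v ^ 2)"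
    using abscissa_rep_mult[of u v 2] v by simp
  then obtain w where w: "mult 2 (Affine u v) = Affine x w"
    using v0 by (cases "mult 2 (Affine u v)") auto
  have uv: "Affine u v \<in> points curve"
    using v by simp
  \<comment> \<open>The ordinate \<open>w\<close> may be \<open>- y\<close>, but on the curve being
    torsion depends on the abscissa only.\<close>
  then have "Affine x w \<in> torsion curve n"
    using mult_in_points[OF uv, of 2] assms w by (simp add: Affine_in_torsion_iff)
  then have "Affine u v \<in> torsion curve (2 * n)"
    using mult_mult[OF uv, of n 2] uv w by (simp add: torsion_def mult.commute)
  moreover have "(x - e) * (2 * v) ^ 2 = ((u - e) ^ 2 - (3 * e ^ 2 + a)) ^ 2"
    if "e ^ 3 + a * e + b = 0" for e
    using u v that by Groebner_Basis.algebra
  ultimately show ?thesis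
    using that v0 by blast
qed

lemma abscissa_diff_square:
  assumes "contains_torsion (2 * n)" "Affine x y \<in> torsion curve n" "e ^ 3 + a * e + b = 0"
  shows "\<exists>s\<in>K. s ^ 2 = x - e"
proof -
  obtain u v where uv: "Affine u v \<in> torsion curve (2 * n)" "v \<noteq> 0"
      "(x - e) * (2 * v) ^ 2 = ((u - e) ^ 2 - (3 * e ^ 2 + a)) ^ 2"
    using half_point[OF assms(2)] assms(3) by metis
  have "u \<in> K" "v \<in> K" "e \<in> K"
    using contains_torsionD[OF assms(1) uv(1)] two_torsion_closed[OF assms(1)] assms(3) by auto
  moreover have "(((u - e) ^ 2 - (3 * e ^ 2 + a)) / (2 * v)) ^ 2 = x - e"
    using uv(2) by (simp add: power_divide flip: uv(3))
  ultimately show ?thesis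
    by (intro bexI[of _ "((u - e) ^ 2 - (3 * e ^ 2 + a)) / (2 * v)"]) auto
qed

text \<open>Two-torsion points can be halved in \<open>K\<close>, so \<open>e1 - e2\<close> and
  \<open>e2 - e1\<close> are both squares; their quotient is \<open>- 1\<close>.\<close>

lemma sqrt_minus_1_closed:
  assumes "contains_torsion 4"
  shows "\<exists>t\<in>K. t ^ 2 = - 1"
proof -
  obtain e1 e2 e3 where e: "\<And>x. x ^ 3 + a * x + b = (x - e1) * (x - e2) * (x - e3)" "e1 \<noteq> e2"
    using cubic_splits by metis
  have r: "e1 ^ 3 + a * e1 + b = 0" "e2 ^ 3 + a * e2 + b = 0"
    using e by auto
  moreover have "contains_torsion (2 * 2)"
    using assms by simp
  ultimately obtain s t where "s \<in> K" "s ^ 2 = e1 - e2" "t \<in> K" "t ^ 2 = e2 - e1"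
    using abscissa_diff_square Affine_in_torsion_2_iff by metis
  then show ?thesis
    using e(2) by (intro bexI[of _ "s / t"]) (auto simp: power_divide divide_eq_eq)
qed

text \<open>The derivatives of the cubic at its roots are fourth powers in \<open>K\<close>, and
  their product is minus the square of the product of root differences, each itself a square. The
  quotient \<open>z\<close> satisfies \<open>z ^ 4 = - 1\<close>, and \<open>z + inverse z\<close>
  is a square root of 2.\<close>

lemma sqrt_2_closed:
  assumes "contains_torsion 8"
  shows "\<exists>t\<in>K. t ^ 2 = 2"
proof -
  obtain e1 e2 e3 where e: "\<And>x. x ^ 3 + a * x + b = (x - e1) * (x - e2) * (x - e3)"
      "e1 \<noteq> e2" "e1 \<noteq> e3" "e2 \<noteq> e3"
    using cubic_splits by metis
  have r: "e1 ^ 3 + a * e1 + b = 0" "e2 ^ 3 + a * e2 + b = 0" "e3 ^ 3 + a * e3 + b = 0"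
    using e by auto
  have 8: "contains_torsion (2 * 4)"
    using assms by simp
  have 4: "contains_torsion (2 * 2)"
    using assms torsion_dvd_mono[of 4 8] by (auto simp: contains_torsion_def)
  \<comment> \<open>For \<open>x = e\<close> the formula of \<open>half_point\<close> reads
    \<open>(u - e) ^ 2 = 3 * e ^ 2 + a\<close>; the half has order dividing 4 and can be halved
    again, so \<open>u - e\<close> is a square too.\<close>
  have g: "\<exists>h\<in>K. (h ^ 2) ^ 2 = 3 * e ^ 2 + a" if root: "e ^ 3 + a * e + b = 0" for e
  proof -
    have "Affine e 0 \<in> torsion curve 2"
      using root by (simp add: Affine_in_torsion_2_iff)
    then show ?thesis
    proof (rule half_point)
      fix u v
      assume uv: "Affine u v \<in> torsion curve (2 * 2)"
        and *: "\<And>e'. e' ^ 3 + a * e' + b = 0 \<Longrightarrow>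
          (e - e') * (2 * v) ^ 2 = ((u - e') ^ 2 - (3 * e' ^ 2 + a)) ^ 2"
      obtain h where "h \<in> K" "h ^ 2 = u - e"
        using abscissa_diff_square[OF 8, of u v e] uv root by auto
      with *[OF root] show ?thesis
        by (intro bexI[of _ h]) auto
    qed
  qed
  obtain h1 h2 h3 where h: "h1 \<in> K" "h2 \<in> K" "h3 \<in> K"
      "(h1 ^ 2) ^ 2 = 3 * e1 ^ 2 + a" "(h2 ^ 2) ^ 2 = 3 * e2 ^ 2 + a" "(h3 ^ 2) ^ 2 = 3 * e3 ^ 2 + a"
    using g r by metis
  obtain d1 d2 d3 where d: "d1 \<in> K" "d2 \<in> K" "d3 \<in> K"
      "d1 ^ 2 = e1 - e2" "d2 ^ 2 = e1 - e3" "d3 ^ 2 = e2 - e3"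
    using abscissa_diff_square[OF 4] Affine_in_torsion_2_iff r by metis
  have e': "3 * e1 ^ 2 + a = (e1 - e2) * (e1 - e3)" "3 * e2 ^ 2 + a = (e2 - e1) * (e2 - e3)"
    "3 * e3 ^ 2 + a = (e3 - e1) * (e3 - e2)"
  proof -
    \<comment> \<open>The values at 0, 1 and -1 recover the coefficients of the cubic from its
      roots.\<close>
    have "b = - (e1 * e2 * e3)"
      using e(1)[of 0] by simp
    moreover have "1 + a + b = (1 - e1) * (1 - e2) * (1 - e3)" "- 1 - a + b = (- 1 - e1) * (- 1 - e2) * (- 1 - e3)"
      using e(1)[of 1] e(1)[of "- 1"] by auto
    ultimately have "2 * (e1 + e2 + e3) = 0" and a: "a = e1 * e2 + e1 * e3 + e2 * e3"
      by Groebner_Basis.algebra+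
    then have "e1 + e2 + e3 = 0"
      by (simp del: distrib_left_numeral)
    with a show "3 * e1 ^ 2 + a = (e1 - e2) * (e1 - e3)" "3 * e2 ^ 2 + a = (e2 - e1) * (e2 - e3)"
      "3 * e3 ^ 2 + a = (e3 - e1) * (e3 - e2)"
      by Groebner_Basis.algebra+
  qed
  define z where "z = (h1 * h2 * h3) / (d1 * d2 * d3)"
  have nz: "d1 * d2 * d3 \<noteq> 0"
    using d e(2-4) by auto
  have "(h1 * h2 * h3) ^ 4 = - ((d1 * d2 * d3) ^ 4)"
  proof -
    have "(h1 * h2 * h3) ^ 4 = (h1 ^ 2) ^ 2 * (h2 ^ 2) ^ 2 * (h3 ^ 2) ^ 2"
      by (simp add: power_mult_distrib)
    also have "\<dots> = - (((e1 - e2) * (e1 - e3) * (e2 - e3)) ^ 2)"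
      unfolding h e' by Groebner_Basis.algebra
    also have "(e1 - e2) * (e1 - e3) * (e2 - e3) = (d1 * d2 * d3) ^ 2"
      by (simp add: power_mult_distrib d)
    finally show ?thesis by simp
  qed
  then have "z ^ 4 = - 1"
    using nz by (simp add: z_def power_divide)
  then have "z ^ 4 + 1 = 0" "z \<noteq> 0"
    by auto
  then have "(z + inverse z) ^ 2 = 2"
  proof -
    have "(z + inverse z) ^ 2 * z ^ 2 = (z ^ 2 + 1) ^ 2"
      using \<open>z \<noteq> 0\<close> by (simp add: field_simps power2_eq_square)
    also have "\<dots> = 2 * z ^ 2"
      using \<open>z ^ 4 + 1 = 0\<close> by Groebner_Basis.algebra
    finally show ?thesis
      using \<open>z \<noteq> 0\<close> by simp
  qed
  moreover have "z + inverse z \<in> K"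
    using h d by (simp add: z_def)
  ultimately show ?thesis by blast
qed

lemma contains_torsion_dvd: "contains_torsion n \<Longrightarrow> m dvd n \<Longrightarrow> contains_torsion m"
  using contains_torsionD unfolding contains_torsion_def[of m] by blast

section \<open>Square roots of the discriminant and of integers\<close>

lemma square_in_discriminant:
  assumes "contains_torsion n" "even n"
  shows "square_in (- (4 * a ^ 3 + 27 * b ^ 2))"
proof -
  obtain e1 e2 e3 where e: "\<And>x. x ^ 3 + a * x + b = (x - e1) * (x - e2) * (x - e3)"
      "- (4 * a ^ 3 + 27 * b ^ 2) = ((e1 - e2) * (e1 - e3) * (e2 - e3)) ^ 2"
    using cubic_splits by metis
  have "x \<in> K" if "x \<in> {e1, e2, e3}" for x
    by (rule two_torsion_closed[OF assms]) (use that e(1)[of x] in auto)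
  then show ?thesis
    unfolding e(2) by (intro square_in_power2) auto
qed

text \<open>Such a \<open>c\<close> carries exactly the sign that \<open>sqrt_odd_closed\<close>
  attaches to \<open>\<bar>c\<bar>\<close>, so torsion of order \<open>2 * \<bar>c\<bar>\<close>
  suffices.\<close>

lemma square_in_1_mod_4:
  assumes "contains_torsion (2 * nat \<bar>c\<bar>)" "[c = 1] (mod 4)"
  shows "square_in (of_int c)"
proof -
  obtain j where j: "c - 1 = 4 * j"
    using assms(2) unfolding cong_iff_dvd_diff by (rule dvdE)
  then have "odd (nat \<bar>c\<bar>)"
    unfolding even_nat_iff[OF abs_ge_zero] dvd_abs_iff by presburger
  then obtain k where k: "nat \<bar>c\<bar> = Suc (2 * k)"
    by (metis oddE Suc_eq_plus1)
  then have abs: "\<bar>c\<bar> = 2 * int k + 1"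
    by linarith
  have "c = (- 1) ^ k * int (Suc (2 * k))"
  proof (cases "c \<ge> 0")
    case True
    with abs j have "int k = 2 * j"
      by linarith
    then have "even k"
      by (metis dvd_triv_left even_of_nat_iff)
    with True abs show ?thesis by simp
  next
    case False
    then have "- c = 2 * int k + 1"
      using abs by simp
    with j have "int k + 2 * j = - 1"
      by simp
    then have "odd (int k)"
      by presburger
    then have "odd k"
      unfolding even_of_nat_iff .
    with False abs show ?thesis by simp
  qed
  then have "(of_int c :: 'a) = of_int ((- 1) ^ k * int (Suc (2 * k)))"
    by (rule arg_cong)
  also have "\<dots> = (- 1) ^ k * of_nat (Suc (2 * k))"
    by (simp only: of_int_mult of_int_power of_int_minus of_int_1 of_int_of_nat_eq)
  finally show ?thesis
    using sqrt_odd_closed[of k] assms(1) unfolding k square_in_def by simp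
qed

text \<open>A square root of \<open>- 1\<close> makes signs harmless. The factor 2 occurs at most
  once in \<open>c\<close>, and if it does then 8 divides \<open>4 * \<bar>c\<bar>\<close>.\<close>

lemma square_in_squarefree:
  assumes "contains_torsion (4 * nat \<bar>c\<bar>)" "squarefree c"
  shows "square_in (of_int c)"
proof -
  have m1: "square_in (- 1)"
    using sqrt_minus_1_closed contains_torsion_dvd[OF assms(1), of 4] unfolding square_in_def by auto
  have *: "square_in (of_nat l)" if l: "odd l" "l dvd nat \<bar>c\<bar>" for l
  proof -
    obtain k where k: "l = Suc (2 * k)"
      using l by (metis oddE Suc_eq_plus1)
    have "square_in ((- 1) ^ k * of_nat l)"
      unfolding square_in_def k
      by (rule sqrt_odd_closed[OF contains_torsion_dvd[OF assms(1)]])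
        (use l in \<open>auto simp: k intro!: mult_dvd_mono simp del: mult_Suc_right\<close>)
    then show ?thesis
      by (rule square_in_cancel_left) (auto intro: square_in_power m1)
  qed
  have "square_in (of_nat (nat \<bar>c\<bar>))"
  proof (cases "even c")
    case False
    then show ?thesis
      by (intro *) (auto simp: even_nat_iff)
  next
    case True
    then obtain l where l: "nat \<bar>c\<bar> = 2 * l"
      by (metis dvd_abs_iff even_nat_iff abs_ge_zero evenE)
    have "odd l"
    proof
      assume "even l"
      then obtain j where "l = 2 * j"
        by (rule evenE)
      with l have "\<bar>c\<bar> = 2 ^ 2 * int j"
        by simp
      then have "(2::int) ^ 2 dvd c"
        by (metis dvd_abs_iff dvd_triv_left)
      with assms(2) have "is_unit (2::int)"
        by (rule squarefreeD)
      then show False by simp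
    qed
    moreover have "square_in 2"
      using sqrt_2_closed contains_torsion_dvd[OF assms(1), of 8] l unfolding square_in_def by auto
    ultimately show ?thesis
      using square_in_mult[OF _ *[of l], of 2] l by simp
  qed
  then have "square_in (of_int \<bar>c\<bar>)"
    by simp
  moreover have "square_in (of_int (sgn c))"
    using m1 square_in_power2[of 1] square_in_power2[of 0] by (cases c "0 :: int" rule: linorder_cases) auto
  ultimately have "square_in (of_int (sgn c * \<bar>c\<bar>))"
    using square_in_mult by simp
  then show ?thesis
    by (simp only: sgn_mult_abs)
qed

text \<open>Put \<open>d = - 3 * c\<close>. As \<open>c - d = 4 * c\<close>, the residue condition
  passes from \<open>d\<close> to \<open>c\<close>, so the two cases for \<open>m\<close> match the
  two preceding lemmas, and \<open>- 3 = d / c\<close>.\<close>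

lemma square_in_minus_3:
  assumes "contains_torsion m" and d: "squarefree d" "3 dvd d"
    and m: "3 * int m = (if [d = 1] (mod 4) then 2 * \<bar>d\<bar> else 4 * \<bar>d\<bar>)"
    and "square_in (of_int d)"
  shows "square_in (- 3)"
proof -
  obtain c' where "d = 3 * c'"
    using d(2) by (rule dvdE)
  then obtain c where c: "d = - 3 * c"
    using that[of "- c'"] by simp
  have "c \<noteq> 0"
    using d(1) c by auto
  have "squarefree c"
    using squarefree_mono[OF _ d(1), of c] unfolding c by simp
  have "square_in (of_int c)"
  proof (cases "[d = 1] (mod 4)")
    case True
    then have "3 * int m = 2 * \<bar>d\<bar>"
      using m by (simp only: if_True)
    then have "m = 2 * nat \<bar>c\<bar>"
      unfolding c abs_mult by simp
    moreover have "[c = 1] (mod 4)"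
    proof -
      have "4 dvd (- 3 * c - 1) + 4 * c"
        using True unfolding c cong_iff_dvd_diff by (rule dvd_add) simp
      moreover have "(- 3 * c - 1) + 4 * c = c - 1"
        by simp
      ultimately show ?thesis
        by (simp only: cong_iff_dvd_diff)
    qed
    ultimately show ?thesis
      using square_in_1_mod_4[of c] assms(1) by simp
  next
    case False
    then have "3 * int m = 4 * \<bar>d\<bar>"
      using m by (simp only: if_False)
    then have "m = 4 * nat \<bar>c\<bar>"
      unfolding c abs_mult by simp
    then show ?thesis
      using square_in_squarefree[of c] assms(1) \<open>squarefree c\<close> by simp
  qed
  from square_in_divide[OF assms(5) this] \<open>c \<noteq> 0\<close> show ?thesis
    by (simp add: c)
qed

section \<open>Torsion of coprime orders\<close>

definition rational_point :: "'a point \<Rightarrow> bool" where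
  "rational_point P \<longleftrightarrow> (\<forall>x y. P = Affine x y \<longrightarrow> x \<in> K \<and> y \<in> K)"

lemma rational_point_add: "rational_point P \<Longrightarrow> rational_point Q \<Longrightarrow> rational_point (P \<oplus>\<^sub>E Q)"
  by (cases P; cases Q) (auto simp: rational_point_def Let_def)

lemma rational_point_neg: "rational_point P \<Longrightarrow> rational_point (\<ominus>\<^sub>E P)"
  by (cases P) (auto simp: rational_point_def)

text \<open>With \<open>m * u = n * v + 1\<close>, a point is its \<open>m * u\<close>-fold minus
  its \<open>n * v\<close>-fold; the first is killed by \<open>n\<close>, the second by
  \<open>m\<close>.\<close>

lemma contains_torsion_coprime_mult:
  assumes "contains_torsion m" "contains_torsion n" "coprime m n" "m \<noteq> 0"
  shows "contains_torsion (m * n)"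
proof -
  have "rational_point P" if P: "P \<in> torsion curve (m * n)" for P
  proof -
    have on: "P \<in> points curve" and O: "mult (m * n) P = Origin"
      using P by (auto simp: torsion_def)
    obtain d u v where "d dvd m" "d dvd n" "m * u = n * v + d"
      using bezout_add_strong_nat[OF assms(4)] by blast
    then have uv: "m * u = n * v + 1"
      using assms(3) by (metis coprime_common_divisor_nat)
    have "mult n (mult (m * u) P) = mult u (mult (m * n) P)"
      "mult m (mult (n * v) P) = mult v (mult (m * n) P)"
      by (simp_all add: mult_ac on flip: mult_mult)
    then have "mult (m * u) P \<in> torsion curve n" "mult (n * v) P \<in> torsion curve m"
      using on O by (simp_all add: torsion_def)
    then have "rational_point (mult (m * u) P)" "rational_point (mult (n * v) P)"
      using assms(1,2) by (auto simp: contains_torsion_def rational_point_def)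
    moreover have "P = mult (m * u) P \<oplus>\<^sub>E \<ominus>\<^sub>E mult (n * v) P"
      unfolding uv using on add_neg_cancel[of P "mult (n * v) P"] by (simp add: mult_Suc)
    ultimately show ?thesis
      by (metis rational_point_add rational_point_neg)
  qed
  then show ?thesis
    unfolding contains_torsion_def rational_point_def by blast
qed

end

section \<open>Reduction to short Weierstrass form\<close>

text \<open>In terms of the standard invariants \<open>c4\<close> and \<open>c6\<close> this is
  \<open>- c4 / 48\<close>, and \<open>short_b\<close> is \<open>- c6 / 864\<close>.\<close>

definition short_a :: "'a::field weierstrass \<Rightarrow> 'a" where
  "short_a E = (2 * wa4 E + wa1 E * wa3 E) / 2 - (wa1 E ^ 2 + 4 * wa2 E) ^ 2 / 48"

definition short_b :: "'a::field weierstrass \<Rightarrow> 'a" where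
  "short_b E = (wa3 E ^ 2 + 4 * wa6 E) / 4
    - (wa1 E ^ 2 + 4 * wa2 E) * (2 * wa4 E + wa1 E * wa3 E) / 24 + (wa1 E ^ 2 + 4 * wa2 E) ^ 3 / 864"

abbreviation short_form :: "'a::field weierstrass \<Rightarrow> 'a weierstrass" where
  "short_form E \<equiv> Weierstrass 0 0 0 (short_a E) (short_b E)"

text \<open>Completes the square in \<open>y\<close> and the cube in \<open>x\<close>.\<close>

fun to_short :: "'a::field weierstrass \<Rightarrow> 'a point \<Rightarrow> 'a point" where
  "to_short E Origin = Origin"
| "to_short E (Affine x y) =
    Affine (x + (wa1 E ^ 2 + 4 * wa2 E) / 12) (y + (wa1 E * x + wa3 E) / 2)"

text \<open>The factor is written as a square because only the square class of the discriminant
  matters.\<close>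

lemma discriminant_short:
  fixes E :: "'a::field_char_0 weierstrass"
  shows "discriminant E = 4 ^ 2 * (- (4 * short_a E ^ 3 + 27 * short_b E ^ 2))"
  unfolding discriminant_def short_a_def short_b_def Let_def
  by (simp add: field_simps) Groebner_Basis.algebra

lemma short_form_nonsingular:
  fixes E :: "'a::field_char_0 weierstrass"
  assumes "discriminant E \<noteq> 0"
  shows "4 * short_a E ^ 3 + 27 * short_b E ^ 2 \<noteq> 0"
proof
  assume eq: "4 * short_a E ^ 3 + 27 * short_b E ^ 2 = 0"
  have "discriminant E = 0"
    unfolding discriminant_short eq by simp
  with assms show False ..
qed

lemma to_short_in_points_iff:
  fixes E :: "'a::field_char_0 weierstrass"
  shows "to_short E P \<in> points (short_form E) \<longleftrightarrow> P \<in> points E"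
proof (cases P)
  case (Affine x y)
  let ?x = "x + (wa1 E ^ 2 + 4 * wa2 E) / 12" and ?y = "y + (wa1 E * x + wa3 E) / 2"
  have "?y ^ 2 - (?x ^ 3 + short_a E * ?x + short_b E) =
    (y ^ 2 + wa1 E * x * y + wa3 E * y) - (x ^ 3 + wa2 E * x ^ 2 + wa4 E * x + wa6 E)"
    unfolding short_a_def short_b_def by (simp add: field_simps) Groebner_Basis.algebra
  then show ?thesis
    by (auto simp: Affine points_def)
qed (simp add: points_def)

lemma to_short_surj:
  fixes E :: "'a::field_char_0 weierstrass"
  shows "to_short E (Affine (x - (wa1 E ^ 2 + 4 * wa2 E) / 12)
    (y - (wa1 E * (x - (wa1 E ^ 2 + 4 * wa2 E) / 12) + wa3 E) / 2)) = Affine x y"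
  by simp

lemma to_short_eq_Origin_iff [simp]: "to_short E P = Origin \<longleftrightarrow> P = Origin"
  by (cases P) auto

text \<open>The change of coordinates is affine and keeps vertical lines vertical, so it respects
  chords and tangents; slopes shift by \<open>wa1 E / 2\<close>.\<close>

lemma to_short_add:
  fixes E :: "'a::field_char_0 weierstrass"
  assumes "P \<in> points E" "Q \<in> points E"
  shows "to_short E (point_add E P Q) = point_add (short_form E) (to_short E P) (to_short E Q)"
proof (cases P; cases Q)
  fix x1 y1 x2 y2 assume PQ: "P = Affine x1 y1" "Q = Affine x2 y2"
  define y1' y2' where "y1' = y1 + (wa1 E * x1 + wa3 E) / 2" and "y2' = y2 + (wa1 E * x2 + wa3 E) / 2"
  define x1' x2' where "x1' = x1 + (wa1 E ^ 2 + 4 * wa2 E) / 12" and "x2' = x2 + (wa1 E ^ 2 + 4 * wa2 E) / 12"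
  have "y1' + y2' = y1 + y2 + wa1 E * x2 + wa3 E" if "x1 = x2"
    using that by (simp add: y1'_def y2'_def field_simps)
  then have opp: "x1' = x2' \<and> y1' + y2' + 0 * x2' + 0 = 0 \<longleftrightarrow> x1 = x2 \<and> y1 + y2 + wa1 E * x2 + wa3 E = 0"
    by (auto simp: x1'_def x2'_def)
  show ?thesis
  proof (cases "x1 = x2 \<and> y1 + y2 + wa1 E * x2 + wa3 E = 0")
    case True
    then show ?thesis
      using opp unfolding PQ by (simp add: x1'_def x2'_def y1'_def y2'_def)
  next
    case False
    define l where "l = (if x1 = x2 then (3 * x1 ^ 2 + 2 * wa2 E * x1 + wa4 E - wa1 E * y1)
      / (2 * y1 + wa1 E * x1 + wa3 E) else (y2 - y1) / (x2 - x1))"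
    define l' where "l' = (if x1' = x2' then (3 * x1' ^ 2 + short_a E) / (2 * y1') else (y2' - y1') / (x2' - x1'))"
    have l': "l' = l + wa1 E / 2"
    proof (cases "x1 = x2")
      case True
      \<comment> \<open>Two points with the same abscissa are equal or opposite. The opposite case
        being excluded, they are equal and the tangent denominator is nonzero.\<close>
      have "(y1 - y2) * (y1 + y2 + wa1 E * x2 + wa3 E) = 0"
        using assms True unfolding PQ points_def by simp Groebner_Basis.algebra
      with True False have nz: "2 * y1 + wa1 E * x1 + wa3 E \<noteq> 0"
        by auto
      have "2 * y1' = 2 * y1 + wa1 E * x1 + wa3 E"
        by (simp add: y1'_def)
      moreover have "3 * x1' ^ 2 + short_a E = (3 * x1 ^ 2 + 2 * wa2 E * x1 + wa4 E - wa1 E * y1)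
          + wa1 E / 2 * (2 * y1 + wa1 E * x1 + wa3 E)"
        unfolding x1'_def short_a_def by (simp add: field_simps) Groebner_Basis.algebra
      ultimately have "l' = ((3 * x1 ^ 2 + 2 * wa2 E * x1 + wa4 E - wa1 E * y1)
          + wa1 E / 2 * (2 * y1 + wa1 E * x1 + wa3 E)) / (2 * y1 + wa1 E * x1 + wa3 E)"
        using True by (simp add: l'_def x1'_def x2'_def)
      also have "\<dots> = l + wa1 E / 2"
        unfolding add_divide_distrib nonzero_mult_div_cancel_right[OF nz] using True by (simp add: l_def)
      finally show ?thesis .
    next
      case neq: False
      then have "y2' - y1' = (y2 - y1) + wa1 E / 2 * (x2 - x1)"
        by (simp add: y1'_def y2'_def field_simps)
      then have "l' = ((y2 - y1) + wa1 E / 2 * (x2 - x1)) / (x2 - x1)"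
        using neq by (simp add: l'_def x1'_def x2'_def)
      also have "\<dots> = l + wa1 E / 2"
        using neq nonzero_mult_div_cancel_right[of "x2 - x1" "wa1 E / 2"]
        unfolding add_divide_distrib by (simp only: l_def if_False) auto
      finally show ?thesis .
    qed
    define x3 where "x3 = l ^ 2 + wa1 E * l - wa2 E - x1 - x2"
    have x3: "l' ^ 2 - x1' - x2' = x3 + (wa1 E ^ 2 + 4 * wa2 E) / 12"
      unfolding l' x3_def x1'_def x2'_def by (simp add: field_simps power2_eq_square)
    have "point_add E P Q = Affine x3 (- (y1 + l * (x3 - x1)) - wa1 E * x3 - wa3 E)"
      using False unfolding PQ by (simp add: Let_def x3_def l_def)
    moreover have "point_add (short_form E) (Affine x1' y1') (Affine x2' y2') =
        Affine (l' ^ 2 - x1' - x2') (- (y1' + l' * (l' ^ 2 - x1' - x2' - x1')))"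
      using False opp by (simp add: Let_def l'_def)
    moreover have "- (y1' + l' * (x3 + (wa1 E ^ 2 + 4 * wa2 E) / 12 - x1')) =
        - (y1 + l * (x3 - x1)) - wa1 E * x3 - wa3 E + (wa1 E * x3 + wa3 E) / 2"
      unfolding l' y1'_def x1'_def by (simp add: field_simps)
    ultimately show ?thesis
      unfolding x3 by (simp add: PQ x1'_def x2'_def y1'_def y2'_def)
  qed
qed auto

lemma to_short_in_torsion_iff:
  fixes E :: "'a::{alg_closed_field, field_char_0} weierstrass"
  assumes "discriminant E \<noteq> 0"
  shows "to_short E P \<in> torsion (short_form E) n \<longleftrightarrow> P \<in> torsion E n"
proof -
  interpret short_weierstrass "short_a E" "short_b E"
    by unfold_locales (rule short_form_nonsingular[OF assms])
  have "to_short E (nat_mult E n P) = mult n (to_short E P) \<and> nat_mult E n P \<in> points E"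
    if P: "P \<in> points E"
  proof (induction n)
    case 0
    then show ?case by (simp add: nat_mult_def)
  next
    case (Suc n)
    have "nat_mult E (Suc n) P = point_add E P (nat_mult E n P)"
      by (simp add: nat_mult_def)
    moreover from this have "to_short E (nat_mult E (Suc n) P) = mult (Suc n) (to_short E P)"
      using Suc P by (simp add: to_short_add mult_Suc)
    ultimately show ?case
      using P to_short_in_points_iff mult_in_points by metis
  qed
  then show ?thesis
    unfolding torsion_def mem_Collect_eq to_short_in_points_iff
    by (metis to_short_eq_Origin_iff)
qed

section \<open>Division fields\<close>

lemma ring_of_type_algebra_simps [simp]:
  "carrier ring_of_type_algebra = UNIV" "\<one>\<^bsub>ring_of_type_algebra\<^esub> = 1" "\<zero>\<^bsub>ring_of_type_algebra\<^esub> = 0"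
  "x \<oplus>\<^bsub>ring_of_type_algebra\<^esub> y = x + y" "x \<otimes>\<^bsub>ring_of_type_algebra\<^esub> y = x * y"
  by (simp_all add: ring_of_type_algebra_def)

lemma a_inv_ring_of_type_algebra [simp]: "\<ominus>\<^bsub>ring_of_type_algebra\<^esub> x = - (x :: 'a::field)"
proof -
  interpret R: field "ring_of_type_algebra :: 'a ring" ..
  show ?thesis by (rule R.minus_equality) auto
qed

lemma m_inv_ring_of_type_algebra [simp]:
  "x \<noteq> 0 \<Longrightarrow> inv\<^bsub>ring_of_type_algebra\<^esub> x = inverse (x :: 'a::field)"
proof -
  interpret R: field "ring_of_type_algebra :: 'a ring" ..
  show "x \<noteq> 0 \<Longrightarrow> ?thesis" by (rule R.comm_inv_char) auto
qed

lemma subfield_set_adjoin_rat: "subfield_set (adjoin_rat S)"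
proof
  show "1 \<in> adjoin_rat S"
    unfolding adjoin_rat_def using generate_field.one[of ring_of_type_algebra] by simp
  show add: "x + y \<in> adjoin_rat S" if "x \<in> adjoin_rat S" "y \<in> adjoin_rat S" for x y
    using that generate_field.eng_add[of x ring_of_type_algebra _ y] unfolding adjoin_rat_def by simp
  show "x * y \<in> adjoin_rat S" if "x \<in> adjoin_rat S" "y \<in> adjoin_rat S" for x y
    using that generate_field.eng_mult[of x ring_of_type_algebra _ y] unfolding adjoin_rat_def by simp
  show uminus: "- x \<in> adjoin_rat S" if "x \<in> adjoin_rat S" for x
    using that generate_field.a_inv[of x ring_of_type_algebra] unfolding adjoin_rat_def by simp
  show "inverse x \<in> adjoin_rat S" if "x \<in> adjoin_rat S" for x
    using that generate_field.m_inv[of x ring_of_type_algebra] unfolding adjoin_rat_def by (cases "x = 0") auto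
qed

lemma adjoin_rat_subset_iff:
  assumes "subfield_set K" "range to_ac \<subseteq> K"
  shows "adjoin_rat S \<subseteq> K \<longleftrightarrow> S \<subseteq> K"
proof
  interpret subfield_set K by fact
  assume "S \<subseteq> K"
  have "x \<in> K" if "x \<in> generate_field ring_of_type_algebra (range to_ac \<union> S)" for x
    using that by induction (use assms(2) \<open>S \<subseteq> K\<close> in auto)
  then show "adjoin_rat S \<subseteq> K"
    unfolding adjoin_rat_def by blast
next
  assume "adjoin_rat S \<subseteq> K"
  then show "S \<subseteq> K"
    unfolding adjoin_rat_def by (auto intro: generate_field.incl)
qed

lemma to_ac_in_adjoin_rat: "range to_ac \<subseteq> adjoin_rat S"
  unfolding adjoin_rat_def by (auto intro: generate_field.incl)

lemma discriminant_base_change: "discriminant (base_change_qbar E) = to_ac (discriminant E)"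
  by (cases E) (simp add: discriminant_def Let_def)

lemma short_base_change:
  "short_a (base_change_qbar E) = to_ac (short_a E)" "short_b (base_change_qbar E) = to_ac (short_b E)"
  by (cases E; simp add: short_a_def short_b_def)+

lemma torsion_field_base_change:
  assumes "elliptic_curve E" "subfield_set K" "range to_ac \<subseteq> K"
  shows "torsion_field (short_a (base_change_qbar E)) (short_b (base_change_qbar E)) K"
proof -
  interpret subfield_set K by fact
  have "discriminant (base_change_qbar E) \<noteq> 0"
    using assms(1) by (simp add: discriminant_base_change elliptic_curve_def)
  from short_form_nonsingular[OF this] show ?thesis
    using assms(3) by unfold_locales (auto simp: short_base_change)
qed

text \<open>The substitution \<open>to_short\<close> and its inverse have coefficients in
  \<open>K\<close>, so coordinates of torsion points lie in \<open>K\<close> for both models or for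
  neither.\<close>

lemma division_field_subset_iff:
  assumes "elliptic_curve E" "subfield_set K" "range to_ac \<subseteq> K"
  shows "division_field E n \<subseteq> K \<longleftrightarrow>
    torsion_field.contains_torsion (short_a (base_change_qbar E)) (short_b (base_change_qbar E)) K n"
proof -
  let ?E = "base_change_qbar E"
  interpret torsion_field "short_a ?E" "short_b ?E" K
    by (rule torsion_field_base_change) fact+
  have disc: "discriminant ?E \<noteq> 0"
    using assms(1) by (simp add: discriminant_base_change elliptic_curve_def)
  have K: "wa1 ?E \<in> K" "wa2 ?E \<in> K" "wa3 ?E \<in> K"
    using assms(3) by (cases E; auto)+
  define r where "r = (wa1 ?E ^ 2 + 4 * wa2 ?E) / 12"
  have r: "r \<in> K"
    using K by (simp add: r_def)
  have "division_field E n \<subseteq> K \<longleftrightarrow> (\<forall>x y. Affine x y \<in> torsion ?E n \<longrightarrow> x \<in> K \<and> y \<in> K)"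
    unfolding division_field_def adjoin_rat_subset_iff[OF assms(2,3)] by blast
  also have "\<dots> \<longleftrightarrow> contains_torsion n"
  proof
    assume L: "\<forall>x y. Affine x y \<in> torsion ?E n \<longrightarrow> x \<in> K \<and> y \<in> K"
    show "contains_torsion n"
      unfolding contains_torsion_def
    proof (intro allI impI)
      fix x y assume "Affine x y \<in> torsion curve n"
      then have "Affine (x - r) (y - (wa1 ?E * (x - r) + wa3 ?E) / 2) \<in> torsion ?E n"
        using to_short_in_torsion_iff[OF disc] to_short_surj[of ?E x y] by (metis r_def)
      with L have *: "x - r \<in> K" "y - (wa1 ?E * (x - r) + wa3 ?E) / 2 \<in> K"
        by blast+
      have "(wa1 ?E * (x - r) + wa3 ?E) / 2 \<in> K"
        using *(1) K by simp
      with *(2) have "y \<in> K"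
        using add_closed by fastforce
      moreover have "x \<in> K"
        using add_closed[OF *(1) r] by simp
      ultimately show "x \<in> K \<and> y \<in> K" by blast
    qed
  next
    assume R: "contains_torsion n"
    show "\<forall>x y. Affine x y \<in> torsion ?E n \<longrightarrow> x \<in> K \<and> y \<in> K"
    proof (intro allI impI)
      fix x y assume "Affine x y \<in> torsion ?E n"
      then have "to_short ?E (Affine x y) \<in> torsion curve n"
        using to_short_in_torsion_iff[OF disc] by blast
      with R have *: "x + r \<in> K" "y + (wa1 ?E * x + wa3 ?E) / 2 \<in> K"
        by (auto simp: contains_torsion_def r_def)
      then have "x \<in> K"
        using diff_closed[OF *(1) r] by simp
      moreover from this have "(wa1 ?E * x + wa3 ?E) / 2 \<in> K"
        using K by simp
      then have "y \<in> K"
        using diff_closed[OF *(2)] by fastforce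
      ultimately show "x \<in> K \<and> y \<in> K" by blast
    qed
  qed
  finally show ?thesis .
qed

text \<open>From \<open>z ^ 2 + z + 1 = 0\<close> follows
  \<open>(2 * z + 1) ^ 2 = - 3\<close>.\<close>

lemma primitive_cube_root_closed:
  assumes "subfield_set K" "subfield_set.square_in K (- 3)" "z ^ 3 = 1" "z \<noteq> (1 :: 'a::field_char_0)"
  shows "z \<in> K"
proof -
  interpret subfield_set K by fact
  obtain t where t: "t \<in> K" "t ^ 2 = - 3"
    using assms(2) by (auto simp: square_in_def)
  have "(z - 1) * (z ^ 2 + z + 1) = 0"
    using assms(3) by (simp add: algebra_simps power2_eq_square power3_eq_cube)
  then have "z ^ 2 + z + 1 = 0"
    using assms(4) by simp
  then have "(2 * z + 1) ^ 2 = t ^ 2"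
    using t(2) by Groebner_Basis.algebra
  then have "2 * z + 1 = t \<or> 2 * z + 1 = - t"
    by (simp add: power2_eq_iff)
  then have "2 * z + 1 \<in> K"
    using t(1) by auto
  then have "((2 * z + 1) - 1) / 2 \<in> K"
    by (intro divide_closed diff_closed numeral_closed one_closed)
  then show ?thesis
    by simp
qed

theorem proposition4p7:
  fixes E :: "rat weierstrass" and \<zeta>\<^sub>3 :: qbar and m :: nat
  assumes "elliptic_curve E"
    and "\<not> has_complex_multiplication E"
    and "\<zeta>\<^sub>3 ^ 3 = 1" and "\<zeta>\<^sub>3 \<noteq> 1"
    and "division_field E 3 = adjoin_rat {\<zeta>\<^sub>3}"
    and "3 dvd rat_squarefree_part (discriminant E)"
    and "m > 0"
    and "3 * int m =
           (if [rat_squarefree_part (discriminant E) = 1] (mod 4)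
            then 2 * \<bar>rat_squarefree_part (discriminant E)\<bar>
            else 4 * \<bar>rat_squarefree_part (discriminant E)\<bar>)"
  shows "division_field E m = division_field E (3 * m)"
proof
  let ?a = "short_a (base_change_qbar E)" and ?b = "short_b (base_change_qbar E)"
  have field: "subfield_set (division_field E n)" "range to_ac \<subseteq> division_field E n" for n
    unfolding division_field_def by (rule subfield_set_adjoin_rat to_ac_in_adjoin_rat)+
  note loc = torsion_field_base_change[OF assms(1) field]
  \<comment> \<open>Reflexivity of inclusion, read through
    \<open>division_field_subset_iff\<close>.\<close>
  have own: "torsion_field.contains_torsion ?a ?b (division_field E n) n" for n
    using division_field_subset_iff[OF assms(1) field] by blast
  show "division_field E m \<subseteq> division_field E (3 * m)"
    unfolding division_field_subset_iff[OF assms(1) field]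
    by (rule torsion_field.contains_torsion_dvd[OF loc own]) simp

  define K where "K = division_field E m"
  interpret torsion_field ?a ?b K
    unfolding K_def by (rule loc)
  have rat: "range to_ac \<subseteq> K"
    unfolding K_def by (rule field)
  have m: "contains_torsion m"
    unfolding K_def by (rule own)
  define d where "d = rat_squarefree_part (discriminant E)"
  have "discriminant E \<noteq> 0"
    using assms(1) by (simp add: elliptic_curve_def)
  then have "is_squarefree_part (discriminant E) d"
    unfolding d_def rat_squarefree_part_def by (rule theI'[OF ex1_squarefree_part])
  then obtain q where d: "squarefree d" and q: "q \<noteq> 0" "discriminant E / of_int d = q ^ 2"
    unfolding is_squarefree_part_def by blast
  have "d \<noteq> 0"
    using d by auto
  have 3: "3 dvd d" "3 * int m = (if [d = 1] (mod 4) then 2 * \<bar>d\<bar> else 4 * \<bar>d\<bar>)"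
    unfolding d_def by fact+
  have "even (3 * int m)"
    unfolding 3(2) by simp
  then have "even m"
    by simp
  \<comment> \<open>Otherwise 9 divides \<open>2 * \<bar>d\<bar>\<close> or
    \<open>4 * \<bar>d\<bar>\<close>, in either case the latter, and hence the squarefree
    \<open>d\<close>.\<close>
  have "\<not> 3 dvd m"
  proof
    assume "3 dvd m"
    then have "3 * 3 dvd 3 * int m"
      by (intro mult_dvd_mono) auto
    then have "3 ^ 2 dvd 4 * \<bar>d\<bar>"
      using dvd_mult[of "3 ^ 2" "2 * \<bar>d\<bar>" 2] unfolding 3(2) by (simp split: if_splits)
    moreover have "coprime (3 ^ 2) (4 :: int)"
      unfolding coprime_iff_gcd_eq_1 by (subst gcd_red_int) simp
    ultimately have "3 ^ 2 dvd d"
      by (metis coprime_dvd_mult_right_iff dvd_abs_iff)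
    with d have "is_unit (3::int)"
      by (rule squarefreeD)
    then show False by simp
  qed
  then have "coprime 3 m"
    by (intro prime_imp_coprime) auto
  have "discriminant E = of_int d * q ^ 2"
    using q \<open>d \<noteq> 0\<close> by (simp add: field_simps)
  then have "discriminant (base_change_qbar E) = of_int d * to_ac q ^ 2"
    by (simp add: discriminant_base_change)
  then have eq: "4 ^ 2 * (- (4 * ?a ^ 3 + 27 * ?b ^ 2)) = of_int d * to_ac q ^ 2"
    unfolding discriminant_short .
  \<comment> \<open>Up to squares of elements of \<open>K\<close>, the integer \<open>d\<close> is
    the discriminant, which is a square in \<open>K\<close> because \<open>m\<close> is
    even.\<close>
  have "of_int d = 4 ^ 2 * (- (4 * ?a ^ 3 + 27 * ?b ^ 2)) / to_ac q ^ 2"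
    unfolding eq using q by simp
  moreover have "square_in (4 ^ 2 * (- (4 * ?a ^ 3 + 27 * ?b ^ 2)) / to_ac q ^ 2)"
    by (intro square_in_divide square_in_mult square_in_discriminant[OF m \<open>even m\<close>] square_in_power2)
      (use rat in auto)
  ultimately have "square_in (of_int d)"
    by simp
  from square_in_minus_3[OF m d 3 this]
  have "\<zeta>\<^sub>3 \<in> K"
    using primitive_cube_root_closed assms(3,4) subfield_set_axioms by blast
  \<comment> \<open>The assumption on the 3-division field enters here: it is generated by
    \<open>\<zeta>\<^sub>3\<close>.\<close>
  then have "division_field E 3 \<subseteq> K"
    unfolding assms(5) by (simp add: adjoin_rat_subset_iff[OF subfield_set_axioms rat])
  then have "contains_torsion 3"
    unfolding division_field_subset_iff[OF assms(1) subfield_set_axioms rat] .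
  then have "contains_torsion (3 * m)"
    using m \<open>coprime 3 m\<close> by (rule contains_torsion_coprime_mult) simp
  then show "division_field E (3 * m) \<subseteq> division_field E m"
    using division_field_subset_iff[OF assms(1) subfield_set_axioms rat] by (simp add: K_def)
qed

end
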